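(* Let $\mathcal{X}=(X_1,X_2,\dots)$ be a stationary and ergodic sequence of real random variables, where each $X_i$ has distribution function $F$ and a density, and suppose $\mathbb{P}(X_1=X_2)=0$. Let $\tilde\xi_{0,n}$ be the restriction to $\tilde\Delta$ of the measure associated with the $0$-th sublevel set persistence diagram of $X_1,\dots,X_n$, and let $\tilde\xi_0$ be the probability measure on $\tilde\Delta$ which is the almost sure weak limit of $\tilde\xi_{0,n}/\tilde\xi_{0,n}(\tilde\Delta)$ as $n\to\infty$. Suppose $f(b,d)=g(d-b)$ for $(b,d)\in\tilde\Delta$, where $g:[0,\infty)\to[0,\infty)$ is a continuous, coercive and largely nondecreasing function with $\mathbb{E}\big[g(2|X_1|)^{1+\epsilon}\big]<\infty$ for some $\epsilon>0$. If $\tilde\xi_0(f)<\infty$, then \[ \frac{\tilde\xi_{0,n}(f)}{\tilde\xi_{0,n}(\tilde\Delta)}\to\tilde\xi_0(f)\quad\text{a.s.},\qquad n\to\infty . \]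
   Context: Stationary means strictly stationary; ergodic means every a.s. shift-invariant event has probability $0$ or $1$. For a measure $\mu$ and function $f$, $\mu(f)=\int f\,d\mu$. A function $g:[0,\infty)\to[0,\infty)$ is coercive if $g(x)\to\infty$ as $x\to\infty$. An unbounded function $g:[0,\infty)\to[0,\infty)$ is largely nondecreasing if there exists $M>0$ such that $\{x:g(x)\ge M\}$ is non-empty and $g$ is nondecreasing on $[g^{\leftarrow}(M),\infty)$, where $g^{\leftarrow}(M)=\inf\{x:g(x)\ge M\}$. Let $\Delta=\{(x,y)\in[-\infty,\infty]^2:-\infty<x<y\le\infty\}$ and $\tilde\Delta=\Delta\cap\mathbb{R}^2$, with their subspace topologies and Borel $\sigma$-algebras. Let $K$ be the graph (simplicial complex) with vertices $v_0,v_1,v_2,\dots$ and edges $\{v_i,v_{i+1}\}$, $i\ge 0$. For $n\ge1$ put $X_{k,n}=X_k$ for $1\le k\le n$, and $X_{k,n}=\infty$ for $k=0$ and for $k>n$. For $t\in\mathbb{R}$ let $K_n(t)=\{\sigma\in K:\max_{v_i\in\sigma}X_{i,n}\le t\}$. Homology is with $\mathbb{Z}_2$ coefficients. The persistence module $\big(H_0(K_n(t))\big)_{t\in\mathbb R}$ with maps induced by inclusions is isomorphic to $\bigoplus_{(b,d)\in PD_0}I(b,d)$ for a unique multiset $PD_0$ of points of $\Delta$ (the $0$-th persistence diagram), where $I(b,d)$ equals $\mathbb{Z}_2$ at $t$ when $b\le t<d$ and $0$ otherwise, with identity maps between nonzero spaces. Set $\xi_{0,n}=\sum_{(b,d)\in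 PD_0}\delta_{(b,d)}$ (with multiplicity) and let $\tilde\xi_{0,n}$ be its restriction to $\mathcal{B}(\tilde\Delta)$. Under the stated assumptions on $\mathcal X$ (stationarity, ergodicity, existence of a density, $\mathbb P(X_1=X_2)=0$), there is a non-random probability measure $\tilde\xi_0$ on $\tilde\Delta$ with $\tilde\xi_{0,n}/\tilde\xi_{0,n}(\tilde\Delta)\Rightarrow\tilde\xi_0$ (weakly) almost surely; this is the $\tilde\xi_0$ in the claim. *)

theory Defs
  imports
    "HOL-Probability.Probability"
    "HOL-Algebra.Product_Groups"
    "HOL-Library.Z2"
    "HOL-Library.Multiset"
begin

section \<open>Growth conditions\<close>

text \<open>A function \<open>[0,\<infinity>) \<rightarrow> [0,\<infinity>)\<close> is rendered as a function on the reals of which only the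
  restriction to \<open>[0,\<infinity>)\<close> matters.\<close>

definition coercive :: "(real \<Rightarrow> real) \<Rightarrow> bool" where
  "coercive g \<longleftrightarrow> filterlim g at_top at_top"

definition gen_inverse :: "(real \<Rightarrow> real) \<Rightarrow> real \<Rightarrow> real" where
  "gen_inverse g M = Inf {x. 0 \<le> x \<and> g x \<ge> M}"

definition largely_nondecreasing :: "(real \<Rightarrow> real) \<Rightarrow> bool" where
  "largely_nondecreasing g \<longleftrightarrow>
     \<not> bdd_above (g ` {0..}) \<and>
     (\<exists>M>0. {x. 0 \<le> x \<and> g x \<ge> M} \<noteq> {} \<and> mono_on {gen_inverse g M..} g)"

section \<open>Stationarity and ergodicity\<close>

text \<open>Sequences are indexed from 1; \<open>X 0\<close> never enters.\<close>

definition seq_from :: "(nat \<Rightarrow> 'w \<Rightarrow> real) \<Rightarrow> nat \<Rightarrow> 'w \<Rightarrow> nat \<Rightarrow> real" where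
  "seq_from X k = (\<lambda>\<omega> i. X (k + i) \<omega>)"

abbreviation seq_algebra :: "(nat \<Rightarrow> real) measure" where
  "seq_algebra \<equiv> (\<Pi>\<^sub>M i\<in>UNIV. borel)"

definition stationary :: "'w measure \<Rightarrow> (nat \<Rightarrow> 'w \<Rightarrow> real) \<Rightarrow> bool" where
  "stationary P X \<longleftrightarrow>
     (\<forall>k\<ge>1. distr P seq_algebra (seq_from X k) = distr P seq_algebra (seq_from X 1))"

definition ergodic :: "'w measure \<Rightarrow> (nat \<Rightarrow> 'w \<Rightarrow> real) \<Rightarrow> bool" where
  "ergodic P X \<longleftrightarrow>
     (\<forall>A\<in>sets seq_algebra.
        (AE \<omega> in P. seq_from X 1 \<omega> \<in> A \<longleftrightarrow> seq_from X 2 \<omega> \<in> A) \<longrightarrow>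
        measure P {\<omega>\<in>space P. seq_from X 1 \<omega> \<in> A} \<in> {0, 1})"

section \<open>Simplicial homology over \<open>\<int>\<^sub>2\<close>\<close>

text \<open>A complex is its set of (finite, nonempty) simplices. Vector spaces over the two-element field
  are represented by their additive groups: additive maps between such spaces are automatically
  linear, so linear maps and isomorphisms are the group homomorphisms and isomorphisms.\<close>

definition chain_group :: "nat \<Rightarrow> 'v set set \<Rightarrow> ('v set \<Rightarrow> bit) monoid" where
  "chain_group p K =
     \<lparr> carrier = {c. finite {\<sigma>. c \<sigma> \<noteq> 0} \<and> {\<sigma>. c \<sigma> \<noteq> 0} \<subseteq> {\<sigma>\<in>K. card \<sigma> = Suc p}},
       mult = (\<lambda>c c' \<sigma>. c \<sigma> + c' \<sigma>),
       one = (\<lambda>_. 0) \<rparr>"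

text \<open>The empty face is excluded (unreduced homology), so the boundary of a 0-chain is 0.\<close>

definition boundary :: "('v set \<Rightarrow> bit) \<Rightarrow> 'v set \<Rightarrow> bit" where
  "boundary c = (\<lambda>\<tau>. if \<tau> = {} then 0
                     else \<Sum>\<sigma> | c \<sigma> \<noteq> 0 \<and> \<tau> \<subset> \<sigma> \<and> card \<sigma> = Suc (card \<tau>). c \<sigma>)"

definition cycles :: "nat \<Rightarrow> 'v set set \<Rightarrow> ('v set \<Rightarrow> bit) set" where
  "cycles p K = {c \<in> carrier (chain_group p K). boundary c = (\<lambda>_. 0)}"

definition boundaries :: "nat \<Rightarrow> 'v set set \<Rightarrow> ('v set \<Rightarrow> bit) set" where
  "boundaries p K = boundary ` carrier (chain_group (Suc p) K)"

definition homology :: "nat \<Rightarrow> 'v set set \<Rightarrow> ('v set \<Rightarrow> bit) set monoid" where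
  "homology p K = (chain_group p K)\<lparr>carrier := cycles p K\<rparr> Mod boundaries p K"

text \<open>The map induced by an inclusion of complexes, the larger one being \<open>L\<close>: it sends the coset of a
  cycle \<open>z\<close> modulo the boundaries of the smaller complex to the coset of \<open>z\<close> modulo those of \<open>L\<close>.\<close>

definition homology_incl ::
  "nat \<Rightarrow> 'v set set \<Rightarrow> ('v set \<Rightarrow> bit) set \<Rightarrow> ('v set \<Rightarrow> bit) set" where
  "homology_incl p L C = boundaries p L <#>\<^bsub>chain_group p L\<^esub> C"

section \<open>Persistence modules\<close>

text \<open>A persistence module over the reals: the spaces and, for \<open>s \<le> t\<close>, the map from time \<open>s\<close> to
  time \<open>t\<close>.\<close>

type_synonym 'a pers_module = "(real \<Rightarrow> 'a monoid) \<times> (real \<Rightarrow> real \<Rightarrow> 'a \<Rightarrow> 'a)"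

definition pers_iso :: "'a pers_module \<Rightarrow> 'b pers_module \<Rightarrow> bool" where
  "pers_iso V W \<longleftrightarrow>
     (\<exists>\<theta>. (\<forall>t. \<theta> t \<in> iso (fst V t) (fst W t)) \<and>
          (\<forall>s t. s \<le> t \<longrightarrow>
             (\<forall>v\<in>carrier (fst V s). \<theta> t (snd V s t v) = snd W s t (\<theta> s v))))"

definition interval_module :: "ereal \<times> ereal \<Rightarrow> bit pers_module" where
  "interval_module = (\<lambda>(b, d).
     (\<lambda>t. \<lparr> carrier = {v. v \<noteq> 0 \<longrightarrow> b \<le> ereal t \<and> ereal t < d}, mult = (+), one = 0 \<rparr>,
      \<lambda>s t v. if b \<le> ereal s \<and> ereal t < d then v else 0))"

definition direct_sum_module :: "'i set \<Rightarrow> ('i \<Rightarrow> 'a pers_module) \<Rightarrow> ('i \<Rightarrow> 'a) pers_module" where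
  "direct_sum_module I V =
     (\<lambda>t. sum_group I (\<lambda>i. fst (V i) t),
      \<lambda>s t v. \<lambda>i\<in>I. snd (V i) s t (v i))"

text \<open>One summand for each occurrence of a point in the multiset.\<close>

definition barcode_module ::
  "(ereal \<times> ereal) multiset \<Rightarrow> ((ereal \<times> ereal) \<times> nat \<Rightarrow> bit) pers_module" where
  "barcode_module D =
     direct_sum_module {(p, k). k < count D p} (\<lambda>(p, k). interval_module p)"

section \<open>The 0-th persistence diagram of a finite sequence\<close>

definition Delta :: "(ereal \<times> ereal) set" where
  "Delta = {(x, y). - \<infinity> < x \<and> x < y \<and> y \<le> \<infinity>}"

definition tilde_Delta :: "(ereal \<times> ereal) set" where
  "tilde_Delta = Delta \<inter> range (map_prod ereal ereal)"

definition line_complex :: "nat set set" where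
  "line_complex = {{i} | i. True} \<union> {{i, Suc i} | i. True}"

definition padded :: "(nat \<Rightarrow> real) \<Rightarrow> nat \<Rightarrow> nat \<Rightarrow> ereal" where
  "padded x n k = (if 1 \<le> k \<and> k \<le> n then ereal (x k) else \<infinity>)"

definition sublevel_complex :: "(nat \<Rightarrow> real) \<Rightarrow> nat \<Rightarrow> real \<Rightarrow> nat set set" where
  "sublevel_complex x n t = {\<sigma>\<in>line_complex. Max (padded x n ` \<sigma>) \<le> ereal t}"

definition sublevel_module :: "(nat \<Rightarrow> real) \<Rightarrow> nat \<Rightarrow> (nat set \<Rightarrow> bit) set pers_module" where
  "sublevel_module x n =
     (\<lambda>t. homology 0 (sublevel_complex x n t),
      \<lambda>s t. homology_incl 0 (sublevel_complex x n t))"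

definition PD0 :: "(nat \<Rightarrow> real) \<Rightarrow> nat \<Rightarrow> (ereal \<times> ereal) multiset" where
  "PD0 x n = (THE D. set_mset D \<subseteq> Delta \<and> pers_iso (sublevel_module x n) (barcode_module D))"

definition counting_measure_of :: "(ereal \<times> ereal) multiset \<Rightarrow> (ereal \<times> ereal) measure" where
  "counting_measure_of D =
     measure_of Delta (sets (restrict_space borel Delta)) (\<lambda>A. \<Sum>p\<in>#D. indicator A p)"

definition xi0 :: "(nat \<Rightarrow> real) \<Rightarrow> nat \<Rightarrow> (ereal \<times> ereal) measure" where
  "xi0 x n = counting_measure_of (PD0 x n)"

definition tilde_xi0 :: "(nat \<Rightarrow> real) \<Rightarrow> nat \<Rightarrow> (ereal \<times> ereal) measure" where
  "tilde_xi0 x n = restrict_space (xi0 x n) tilde_Delta"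

section \<open>Weak convergence\<close>

definition normalized :: "'a measure \<Rightarrow> 'a measure" where
  "normalized N = scale_measure (inverse (emeasure N (space N))) N"

text \<open>Weak convergence of finite measures on the topological space carried by \<open>space N\<close> with the
  subspace topology.\<close>

definition converges_weakly :: "(nat \<Rightarrow> 'a::topological_space measure) \<Rightarrow> 'a measure \<Rightarrow> bool" where
  "converges_weakly Ns N \<longleftrightarrow>
     (\<forall>h::'a \<Rightarrow> real. continuous_on (space N) h \<and> bounded (h ` space N) \<longrightarrow>
        (\<lambda>n. \<integral>x. h x \<partial>Ns n) \<longlonglongrightarrow> (\<integral>x. h x \<partial>N))"

text \<open>The set function defining \<open>counting_measure_of\<close> is indeed a measure.\<close>

lemma space_counting_measure_of [simp]: "space (counting_measure_of D) = Delta"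
  by (simp add: counting_measure_of_def space_measure_of_conv)

lemma sets_counting_measure_of [simp]:
  "sets (counting_measure_of D) = sets (restrict_space borel Delta)"
proof -
  have "sigma_algebra Delta (sets (restrict_space borel Delta))"
    using sets.sigma_algebra_axioms[of "restrict_space borel Delta"]
    by (simp add: space_restrict_space)
  then show ?thesis
    by (simp add: counting_measure_of_def sigma_algebra.sets_measure_of_eq)
qed

lemma emeasure_counting_measure_of:
  assumes "A \<in> sets (restrict_space borel Delta)"
  shows "emeasure (counting_measure_of D) A = (\<Sum>p\<in>#D. indicator A p)"
proof (rule emeasure_measure_of[OF counting_measure_of_def])
  show "sets (restrict_space borel Delta) \<subseteq> Pow Delta"
    using sets.space_closed[of "restrict_space borel Delta"] by (simp add: space_restrict_space)
  show "A \<in> sets (counting_measure_of D)" using assms by simp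
  show "positive (sets (counting_measure_of D)) (\<lambda>A. \<Sum>p\<in>#D. indicator A p)"
    by (simp add: positive_def)
  show "countably_additive (sets (counting_measure_of D)) (\<lambda>A. \<Sum>p\<in>#D. indicator A p)"
  proof (rule countably_additiveI)
    fix B :: "nat \<Rightarrow> (ereal \<times> ereal) set"
    assume "disjoint_family B"
    then show "(\<Sum>i. \<Sum>p\<in>#D. indicator (B i) p) = (\<Sum>p\<in>#D. indicator (\<Union> (range B)) p :: ennreal)"
    proof (induction D)
      case (add p D)
      then show ?case
        by (simp add: suminf_add[symmetric] suminf_indicator)
    qed simp
  qed
qed

end

theory Submission
  imports Defs
begin

text \<open>Weak convergence handles every bounded truncation \<open>min f C\<close>, so the content of the theorem is uniform
integrability: bars of large \<open>f\<close>-value must contribute little to the average, uniformly in \<open>n\<close>.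

Bars of large persistence are controlled by large values of the sequence. If \<open>d - b\<close> exceeds a
threshold beyond which \<open>g\<close> is monotone, then \<open>d - b \<le> 2 * max \<bar>b\<bar> \<bar>d\<bar>\<close> gives
\<open>g (d - b) \<le> g (2 * \<bar>b\<bar>) + g (2 * \<bar>d\<bar>)\<close>, with only the terms counted whose argument is itself beyond the
threshold (\<open>truncation_error_le\<close>). Births and finite deaths of the diagram are values of the sequence,
where each index serves for at most one birth and at most two deaths (\<open>sum_births_le\<close>,
\<open>sum_deaths_le\<close>). Hence the total excess over all bars is at most three times the sum over \<open>i \<le> n\<close> of the tail
part of \<open>g (2 * \<bar>X i\<bar>)\<close>. As \<open>g (2 * \<bar>X 1\<bar>)\<close> is integrable, the expectations of these tail parts tend to zero, and the maximal ergodic inequality turns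
this into an almost sure bound on their averages that holds for all \<open>n\<close> simultaneously
(\<open>maximal_inequality_null\<close>).

It remains to see that the number of finite bars grows linearly in \<open>n\<close>. Every strict interior local
minimum starts a bar, and all but one bar are finite (\<open>card_local_minima_le\<close>). By ergodicity and the
maximal inequality once more, local minima occur with positive lower frequency as soon as they have
positive probability (\<open>ergodic_visits\<close>). If they had probability zero, a descent would always be
followed by a descent; then either almost surely \<open>X 2 < X 1\<close> or almost surely \<open>X 1 < X 2\<close>, which is
impossible for identically distributed variables (\<open>prob_local_min_pos\<close>).

All of this needs the diagram in concrete form. It is given by the elder rule: the class born at a
vertex \<open>i\<close> dies when its component first meets an older vertex. \<open>PD0_eq_barcode\<close> proves this by an
explicit isomorphism of persistence modules, together with the uniqueness of the barcode, which is
read off from the ranks of the structure maps.\<close>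

section \<open>Single-linkage merging on a path\<close>

text \<open>The level at which \<open>i\<close> and \<open>j\<close> become connected in the sublevel filtration of a path; \<open>path_max_trans\<close> is
the ultrametric inequality for it.\<close>

definition path_max :: "(nat \<Rightarrow> real) \<Rightarrow> nat \<Rightarrow> nat \<Rightarrow> real" where
  "path_max x i j = Max (x ` {min i j..max i j})"

lemma path_max_le_iff: "path_max x i j \<le> t \<longleftrightarrow> (\<forall>k\<in>{min i j..max i j}. x k \<le> t)"
  unfolding path_max_def by (subst Max_le_iff) auto

lemma path_max_commute: "path_max x i j = path_max x j i"
  by (simp add: path_max_def min.commute max.commute)

lemma path_max_refl [simp]: "path_max x i i = x i"
  by (simp add: path_max_def)

lemma path_max_trans:
  assumes "path_max x i j \<le> t" "path_max x j k \<le> t"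
  shows "path_max x i k \<le> t"
  unfolding path_max_le_iff
proof
  fix l assume "l \<in> {min i k..max i k}"
  then have "l \<in> {min i j..max i j} \<or> l \<in> {min j k..max j k}" by auto
  then show "x l \<le> t" using assms unfolding path_max_le_iff by blast
qed

lemma path_max_attained: "\<exists>m\<in>{min i j..max i j}. path_max x i j = x m"
proof -
  have "Max (x ` {min i j..max i j}) \<in> x ` {min i j..max i j}" by (rule Max_in) auto
  then show ?thesis unfolding path_max_def by blast
qed

text \<open>Age is measured by the birth level; the index breaks ties, so that the order is total also when
values coincide.\<close>

definition older :: "(nat \<Rightarrow> real) \<Rightarrow> nat \<Rightarrow> nat \<Rightarrow> bool" where
  "older x i j \<longleftrightarrow> x i < x j \<or> (x i = x j \<and> i < j)"

lemma older_trans: "older x i j \<Longrightarrow> older x j k \<Longrightarrow> older x i k"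
  by (auto simp: older_def)

lemma older_linear: "i \<noteq> j \<Longrightarrow> older x i j \<or> older x j i"
  by (auto simp: older_def)

lemma older_irrefl [simp]: "\<not> older x i i"
  by (auto simp: older_def)

lemma older_le: "older x i j \<Longrightarrow> x i \<le> x j"
  by (auto simp: older_def)

lemma finite_older_minimal:
  assumes "finite A" "A \<noteq> {}"
  obtains i where "i \<in> A" "\<And>j. j \<in> A \<Longrightarrow> \<not> older x j i"
proof -
  have "asymp_on A (older x)" "transp_on A (older x)"
    by (auto intro!: asymp_onI transp_onI simp: older_def)
  from Finite_Set.bex_min_element[OF assms(1) this assms(2)] show ?thesis
    using that older_irrefl by metis
qed

lemma finite_older_maximal:
  assumes "finite A" "A \<noteq> {}"
  obtains i where "i \<in> A" "\<And>j. j \<in> A \<Longrightarrow> \<not> older x i j"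
proof -
  have "asymp_on A (older x)" "transp_on A (older x)"
    by (auto intro!: asymp_onI transp_onI simp: older_def)
  from Finite_Set.bex_max_element[OF assms(1) this assms(2)] show ?thesis
    using that older_irrefl by metis
qed

text \<open>The infimum over the empty set is \<open>\<infinity>\<close>, which is the correct death time of the oldest vertex.\<close>

definition death :: "(nat \<Rightarrow> real) \<Rightarrow> nat \<Rightarrow> nat \<Rightarrow> ereal" where
  "death x n i = (INF j\<in>{j\<in>{1..n}. older x j i}. ereal (path_max x i j))"

lemma death_attained:
  assumes "death x n i \<noteq> \<infinity>"
  shows "\<exists>j\<in>{1..n}. older x j i \<and> death x n i = ereal (path_max x i j)"
proof -
  let ?A = "{j\<in>{1..n}. older x j i}"
  have ne: "?A \<noteq> {}"
  proof
    assume "?A = {}"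
    then have "death x n i = Orderings.top" unfolding death_def by (simp only: image_empty Inf_empty)
    then show False using assms by (simp add: top_ereal_def)
  qed
  have "death x n i = Min ((\<lambda>j. ereal (path_max x i j)) ` ?A)"
    unfolding death_def using ne by (subst Min_Inf) auto
  also have "\<dots> \<in> (\<lambda>j. ereal (path_max x i j)) ` ?A"
    using ne by (intro Min_in) auto
  finally show ?thesis by auto
qed

lemma death_le: "j \<in> {1..n} \<Longrightarrow> older x j i \<Longrightarrow> death x n i \<le> ereal (path_max x i j)"
  unfolding death_def by (intro INF_lower) auto

text \<open>Any older vertex in the component at the time of merging will do; it need not be the oldest one.\<close>

definition elder :: "(nat \<Rightarrow> real) \<Rightarrow> nat \<Rightarrow> nat \<Rightarrow> nat" where
  "elder x n i = (SOME j. j \<in> {1..n} \<and> older x j i \<and> death x n i = ereal (path_max x i j))"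

lemma elder:
  assumes "death x n i \<noteq> \<infinity>"
  shows "elder x n i \<in> {1..n}" "older x (elder x n i) i"
    "death x n i = ereal (path_max x i (elder x n i))"
  using someI_ex[of "\<lambda>j. j \<in> {1..n} \<and> older x j i \<and> death x n i = ereal (path_max x i j)"]
    death_attained[OF assms] unfolding elder_def by blast+

text \<open>Vertices with \<open>death x n i = x i\<close> join an older component at the moment they appear and contribute no
bar.\<close>

definition bars :: "(nat \<Rightarrow> real) \<Rightarrow> nat \<Rightarrow> nat set" where
  "bars x n = {i\<in>{1..n}. ereal (x i) < death x n i}"

definition barcode :: "(nat \<Rightarrow> real) \<Rightarrow> nat \<Rightarrow> (ereal \<times> ereal) multiset" where
  "barcode x n = image_mset (\<lambda>i. (ereal (x i), death x n i)) (mset_set (bars x n))"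

lemma finite_bars [simp]: "finite (bars x n)"
  by (simp add: bars_def)

lemma barcode_in_Delta: "set_mset (barcode x n) \<subseteq> Delta"
  by (auto simp: barcode_def Delta_def bars_def)

section \<open>Homology in degree zero\<close>

lemma mult_chain_group [simp]: "c \<otimes>\<^bsub>chain_group p K\<^esub> c' = (\<lambda>\<sigma>. c \<sigma> + c' \<sigma>)"
  by (simp add: chain_group_def)

lemma one_chain_group [simp]: "\<one>\<^bsub>chain_group p K\<^esub> = (\<lambda>_. 0)"
  by (simp add: chain_group_def)

lemma carrier_chain_group:
  "c \<in> carrier (chain_group p K) \<longleftrightarrow>
     finite {\<sigma>. c \<sigma> \<noteq> 0} \<and> (\<forall>\<sigma>. c \<sigma> \<noteq> 0 \<longrightarrow> \<sigma> \<in> K \<and> card \<sigma> = Suc p)"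
  by (auto simp: chain_group_def)

text \<open>By default, sums of bits are simplified to Boolean operations, which destroys the group
  structure that the following proofs compute with.\<close>

declare add_bit_eq_xor [simp del] mult_bit_eq_and [simp del]
  bit_not_zero_iff [simp del] bit_not_one_iff [simp del]

lemma bit_add_self [simp]: "(a::bit) + a = 0"
  by (cases a) (simp_all add: add_bit_eq_xor)

lemma bit_add_self_left [simp]: "(a::bit) + (a + b) = b"
  by (metis add.assoc add_0 bit_add_self)

lemma bit_add_eq_0_iff: "(a::bit) + b = 0 \<longleftrightarrow> a = b"
  by (metis add.assoc add_0 add.commute bit_add_self)

lemma chain_add_closed:
  assumes "c \<in> carrier (chain_group p K)" "c' \<in> carrier (chain_group p K)"
  shows "(\<lambda>\<sigma>. c \<sigma> + c' \<sigma>) \<in> carrier (chain_group p K)"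
proof -
  have "{\<sigma>. c \<sigma> + c' \<sigma> \<noteq> 0} \<subseteq> {\<sigma>. c \<sigma> \<noteq> 0} \<union> {\<sigma>. c' \<sigma> \<noteq> 0}" by (auto simp: bit_add_eq_0_iff)
  moreover have "finite ({\<sigma>. c \<sigma> \<noteq> 0} \<union> {\<sigma>. c' \<sigma> \<noteq> 0})" 
    using assms unfolding carrier_chain_group by blast
  ultimately have "finite {\<sigma>. c \<sigma> + c' \<sigma> \<noteq> 0}" by (rule finite_subset)
  moreover have "\<sigma> \<in> K \<and> card \<sigma> = Suc p" if "c \<sigma> + c' \<sigma> \<noteq> 0" for \<sigma>
  proof -
    have "c \<sigma> \<noteq> 0 \<or> c' \<sigma> \<noteq> 0" using that by (metis add_0)
    then show ?thesis using assms unfolding carrier_chain_group by blast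
  qed
  ultimately show ?thesis unfolding carrier_chain_group by blast
qed

lemma comm_group_chain_group: "comm_group (chain_group p K)"
proof (rule comm_groupI)
  fix c assume c: "c \<in> carrier (chain_group p K)"
  show "\<exists>y\<in>carrier (chain_group p K). y \<otimes>\<^bsub>chain_group p K\<^esub> c = \<one>\<^bsub>chain_group p K\<^esub>"
    using c by (intro bexI[of _ c]) auto
qed (auto simp: chain_add_closed add_ac, auto simp: carrier_chain_group)

lemma boundary_eq_sum:
  assumes "finite S" "{\<sigma>. c \<sigma> \<noteq> 0} \<subseteq> S" "\<tau> \<noteq> {}"
  shows "boundary c \<tau> = (\<Sum>\<sigma>\<in>{\<sigma>\<in>S. \<tau> \<subset> \<sigma> \<and> card \<sigma> = Suc (card \<tau>)}. c \<sigma>)"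
proof -
  have "boundary c \<tau> = (\<Sum>\<sigma> | c \<sigma> \<noteq> 0 \<and> \<tau> \<subset> \<sigma> \<and> card \<sigma> = Suc (card \<tau>). c \<sigma>)"
    using assms(3) by (simp add: boundary_def)
  also have "\<dots> = (\<Sum>\<sigma>\<in>{\<sigma>\<in>S. \<tau> \<subset> \<sigma> \<and> card \<sigma> = Suc (card \<tau>)}. c \<sigma>)"
    using assms(1,2) by (intro sum.mono_neutral_left) auto
  finally show ?thesis .
qed

lemma boundary_add:
  assumes "finite {\<sigma>. c \<sigma> \<noteq> 0}" "finite {\<sigma>. c' \<sigma> \<noteq> 0}"
  shows "boundary (\<lambda>\<sigma>. c \<sigma> + c' \<sigma>) = (\<lambda>\<tau>. boundary c \<tau> + boundary c' \<tau>)"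
proof
  fix \<tau> :: "'a set"
  let ?S = "{\<sigma>. c \<sigma> \<noteq> 0} \<union> {\<sigma>. c' \<sigma> \<noteq> 0}"
  have fin: "finite ?S" using assms by blast
  show "boundary (\<lambda>\<sigma>. c \<sigma> + c' \<sigma>) \<tau> = boundary c \<tau> + boundary c' \<tau>"
  proof (cases "\<tau> = {}")
    case False
    have sub: "{\<sigma>. c \<sigma> + c' \<sigma> \<noteq> 0} \<subseteq> ?S" by (auto simp: bit_add_eq_0_iff)
    show ?thesis
      using boundary_eq_sum[OF fin sub False] boundary_eq_sum[OF fin _ False, of c]
        boundary_eq_sum[OF fin _ False, of c'] by (simp add: sum.distrib)
  qed (simp add: boundary_def)
qed

lemma boundary_zero: "boundary (\<lambda>_. 0) = (\<lambda>_. 0)"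
  by (rule ext) (simp add: boundary_def)

text \<open>A 0-chain consists of singletons, and the only proper face of a singleton is the empty one, on which
the boundary is zero by definition.\<close>

lemma cycles_0: "cycles 0 K = carrier (chain_group 0 K)"
proof -
  have "boundary c \<tau> = 0" if c: "c \<in> carrier (chain_group 0 K)" for c \<tau>
  proof -
    have "{\<sigma>. c \<sigma> \<noteq> 0 \<and> \<tau> \<subset> \<sigma> \<and> card \<sigma> = Suc (card \<tau>)} = {}" if "\<tau> \<noteq> {}"
    proof -
      have False if "c \<sigma> \<noteq> 0" "\<tau> \<subset> \<sigma>" for \<sigma>
      proof -
        have "card \<sigma> = 1" using c that(1) unfolding carrier_chain_group by simp
        then obtain a where "\<sigma> = {a}" by (auto simp: card_1_singleton_iff)
        then show False using that(2) \<open>\<tau> \<noteq> {}\<close> by auto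
      qed
      then show ?thesis by blast
    qed
    then show ?thesis unfolding boundary_def by (cases "\<tau> = {}") (simp_all del: Collect_empty_eq)
  qed
  then show ?thesis unfolding cycles_def by auto
qed

lemma homology_0: "homology 0 K = chain_group 0 K Mod boundaries 0 K"
  unfolding homology_def cycles_0 by simp

definition down_closed :: "'v set set \<Rightarrow> bool" where
  "down_closed K \<longleftrightarrow> (\<forall>\<sigma>\<in>K. \<forall>\<tau>. \<tau> \<noteq> {} \<and> \<tau> \<subseteq> \<sigma> \<longrightarrow> \<tau> \<in> K)"

lemma boundary_in_chain_group:
  assumes K: "down_closed K" and c: "c \<in> carrier (chain_group (Suc p) K)"
  shows "boundary c \<in> carrier (chain_group p K)"
proof -
  let ?S = "{\<sigma>. c \<sigma> \<noteq> 0}"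
  have fin: "finite ?S" using c unfolding carrier_chain_group by blast
  have face: "\<exists>\<sigma>. c \<sigma> \<noteq> 0 \<and> \<tau> \<subset> \<sigma> \<and> card \<sigma> = Suc (card \<tau>) \<and> \<tau> \<noteq> {}" 
    if "boundary c \<tau> \<noteq> 0" for \<tau>
  proof (rule ccontr)
    assume no: "\<not> ?thesis"
    have "\<tau> \<noteq> {}" using that by (auto simp: boundary_def)
    then have "{\<sigma>. c \<sigma> \<noteq> 0 \<and> \<tau> \<subset> \<sigma> \<and> card \<sigma> = Suc (card \<tau>)} = {}" using no by blast
    then have "boundary c \<tau> = 0" using \<open>\<tau> \<noteq> {}\<close> unfolding boundary_def by (simp only: sum.empty if_False)
    then show False using that by blast
  qed
  have "{\<tau>. boundary c \<tau> \<noteq> 0} \<subseteq> (\<Union>\<sigma>\<in>?S. Pow \<sigma>)" using face by blast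
  moreover have "finite (\<Union>\<sigma>\<in>?S. Pow \<sigma>)"
  proof (rule finite_UN_I[OF fin])
    fix \<sigma> assume "\<sigma> \<in> ?S"
    then have "card \<sigma> = Suc (Suc p)" using c unfolding carrier_chain_group by blast
    then have "finite \<sigma>" using card.infinite by fastforce
    then show "finite (Pow \<sigma>)" by simp
  qed
  ultimately have "finite {\<tau>. boundary c \<tau> \<noteq> 0}" by (rule finite_subset)
  moreover have "\<tau> \<in> K \<and> card \<tau> = Suc p" if nz: "boundary c \<tau> \<noteq> 0" for \<tau>
  proof -
    obtain \<sigma> where s: "c \<sigma> \<noteq> 0" "\<tau> \<subset> \<sigma>" "card \<sigma> = Suc (card \<tau>)" "\<tau> \<noteq> {}" using face[OF nz] by blast
    then have "\<sigma> \<in> K" "card \<sigma> = Suc (Suc p)" using c unfolding carrier_chain_group by blast+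
    then show ?thesis using s K unfolding down_closed_def by auto
  qed
  ultimately show ?thesis unfolding carrier_chain_group by blast
qed

lemma boundaries_add:
  assumes "a \<in> boundaries p K" "b \<in> boundaries p K"
  shows "(\<lambda>\<sigma>. a \<sigma> + b \<sigma>) \<in> boundaries p K"
proof -
  obtain c c' where c: "c \<in> carrier (chain_group (Suc p) K)" "a = boundary c"
     "c' \<in> carrier (chain_group (Suc p) K)" "b = boundary c'"
    using assms unfolding boundaries_def by blast
  have "(\<lambda>\<sigma>. a \<sigma> + b \<sigma>) = boundary (\<lambda>\<sigma>. c \<sigma> + c' \<sigma>)"
    unfolding c(2,4) using c(1,3) unfolding carrier_chain_group by (subst boundary_add) auto
  then show ?thesis unfolding boundaries_def using chain_add_closed[OF c(1,3)] by blast
qed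

lemma boundaries_zero: "(\<lambda>_. 0) \<in> boundaries p K"
proof -
  have "(\<lambda>_. 0) \<in> carrier (chain_group (Suc p) K)" by (simp add: carrier_chain_group)
  then have "boundary (\<lambda>_. 0) \<in> boundaries p K" unfolding boundaries_def by (rule imageI)
  then show ?thesis by (simp only: boundary_zero)
qed

lemma boundaries_mono: "K \<subseteq> L \<Longrightarrow> boundaries p K \<subseteq> boundaries p L"
  unfolding boundaries_def by (intro image_mono subsetI) (simp add: carrier_chain_group subset_iff)

lemma boundaries_subgroup:
  assumes "down_closed K"
  shows "subgroup (boundaries p K) (chain_group p K)"
proof -
  interpret comm_group "chain_group p K" by (rule comm_group_chain_group)
  show ?thesis
  proof (rule subgroupI)
    show "boundaries p K \<subseteq> carrier (chain_group p K)"
      unfolding boundaries_def using boundary_in_chain_group[OF assms] by blast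
    show "boundaries p K \<noteq> {}" using boundaries_zero by blast
    fix a b assume a: "a \<in> boundaries p K" and b: "b \<in> boundaries p K"
    have "a \<in> carrier (chain_group p K)" 
      using a \<open>boundaries p K \<subseteq> carrier (chain_group p K)\<close> by blast
    then have "inv\<^bsub>chain_group p K\<^esub> a = a" by (intro inv_equality) auto
    then show "inv\<^bsub>chain_group p K\<^esub> a \<in> boundaries p K" using a by simp
    show "a \<otimes>\<^bsub>chain_group p K\<^esub> b \<in> boundaries p K" using boundaries_add[OF a b] by simp
  qed
qed

lemma boundaries_normal: "down_closed K \<Longrightarrow> boundaries p K \<lhd> chain_group p K"
  by (simp only: comm_group.normal_iff_subgroup[OF comm_group_chain_group] boundaries_subgroup)

text \<open>Every chain in degree zero is a cycle, so these cosets are the elements of the homology group.\<close>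

definition homology_class :: "nat \<Rightarrow> 'v set set \<Rightarrow> ('v set \<Rightarrow> bit) \<Rightarrow> ('v set \<Rightarrow> bit) set" where
  "homology_class p K c = (\<lambda>h \<sigma>. h \<sigma> + c \<sigma>) ` boundaries p K"

lemma mem_homology_class_self: "c \<in> homology_class p K c"
proof -
  have "c = (\<lambda>h \<sigma>. h \<sigma> + c \<sigma>) (\<lambda>_. 0)" by simp
  then show ?thesis unfolding homology_class_def using boundaries_zero[of p K] by (rule image_eqI)
qed

lemma r_coset_eq_homology_class: "boundaries p K #>\<^bsub>chain_group p L\<^esub> c = homology_class p K c"
  unfolding r_coset_def homology_class_def mult_chain_group by blast

lemma carrier_homology_0: "carrier (homology 0 K) = homology_class 0 K ` carrier (chain_group 0 K)"
  unfolding homology_0 carrier_FactGroup r_coset_eq_homology_class ..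

lemma mult_homology_0:
  assumes "down_closed K" "a \<in> carrier (chain_group 0 K)" "b \<in> carrier (chain_group 0 K)"
  shows "homology_class 0 K a \<otimes>\<^bsub>homology 0 K\<^esub> homology_class 0 K b = homology_class 0 K (\<lambda>\<sigma>. a \<sigma> + b \<sigma>)"
proof -
  from normal.rcos_sum[OF boundaries_normal[OF assms(1)] assms(2,3)] show ?thesis
    unfolding homology_0 mult_FactGroup by (simp add: r_coset_eq_homology_class)
qed

lemma homology_class_eq_iff: "homology_class p K a = homology_class p K b \<longleftrightarrow> (\<lambda>\<sigma>. a \<sigma> + b \<sigma>) \<in> boundaries p K"
proof
  assume "homology_class p K a = homology_class p K b"
  then have "a \<in> homology_class p K b"
    by (metis mem_homology_class_self)
  then obtain h where h: "h \<in> boundaries p K" "a = (\<lambda>\<sigma>. h \<sigma> + b \<sigma>)" unfolding homology_class_def by blast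
  then have "(\<lambda>\<sigma>. a \<sigma> + b \<sigma>) = h" by (simp add: add.assoc)
  then show "(\<lambda>\<sigma>. a \<sigma> + b \<sigma>) \<in> boundaries p K" using h by simp
next
  have sub: "homology_class p K a \<subseteq> homology_class p K b" if *: "(\<lambda>\<sigma>. a \<sigma> + b \<sigma>) \<in> boundaries p K" for a b
  proof
    fix c assume "c \<in> homology_class p K a"
    then obtain h where h: "h \<in> boundaries p K" "c = (\<lambda>\<sigma>. h \<sigma> + a \<sigma>)" unfolding homology_class_def by blast
    have "c = (\<lambda>\<sigma>. (h \<sigma> + (a \<sigma> + b \<sigma>)) + b \<sigma>)" unfolding h(2) by (simp add: add.assoc)
    then show "c \<in> homology_class p K b"
      unfolding homology_class_def using boundaries_add[OF h(1) *] by (rule image_eqI)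
  qed
  assume *: "(\<lambda>\<sigma>. a \<sigma> + b \<sigma>) \<in> boundaries p K"
  then have "(\<lambda>\<sigma>. b \<sigma> + a \<sigma>) \<in> boundaries p K" by (simp add: add.commute)
  then show "homology_class p K a = homology_class p K b" using sub * by blast
qed

text \<open>The induced maps act on representatives as the identity, since boundaries of the subcomplex are
absorbed by those of the larger one.\<close>

lemma homology_incl_class:
  assumes "K \<subseteq> L"
  shows "homology_incl p L (homology_class p K a) = homology_class p L a"
proof
  show "homology_incl p L (homology_class p K a) \<subseteq> homology_class p L a"
  proof
    fix c assume "c \<in> homology_incl p L (homology_class p K a)"
    then obtain h k where "h \<in> boundaries p L" "k \<in> boundaries p K" "c = (\<lambda>\<sigma>. (h \<sigma> + k \<sigma>) + a \<sigma>)"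
      unfolding homology_incl_def set_mult_def homology_class_def by (auto simp: add.assoc)
    moreover from this have "(\<lambda>\<sigma>. h \<sigma> + k \<sigma>) \<in> boundaries p L"
      using boundaries_mono[OF assms] by (intro boundaries_add) auto
    ultimately show "c \<in> homology_class p L a" unfolding homology_class_def by (intro image_eqI)
  qed
  show "homology_class p L a \<subseteq> homology_incl p L (homology_class p K a)"
  proof
    fix c assume "c \<in> homology_class p L a"
    then obtain h where h: "h \<in> boundaries p L" "c = (\<lambda>\<sigma>. h \<sigma> + a \<sigma>)" unfolding homology_class_def by blast
    have "a \<in> homology_class p K a"
      by (metis mem_homology_class_self)
    then show "c \<in> homology_incl p L (homology_class p K a)"
      unfolding homology_incl_def set_mult_def using h by auto
  qed
qed

section \<open>Homology of the sublevel complexes of a sequence\<close>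

definition vertex_chain :: "nat \<Rightarrow> nat set \<Rightarrow> bit" where
  "vertex_chain i = (\<lambda>\<sigma>. if \<sigma> = {i} then 1 else 0)"

definition sublevel_vertex :: "(nat \<Rightarrow> real) \<Rightarrow> nat \<Rightarrow> real \<Rightarrow> nat \<Rightarrow> bool" where
  "sublevel_vertex x n t i \<longleftrightarrow> i \<in> {1..n} \<and> x i \<le> t"

lemma sublevel_complex_iff:
  "\<sigma> \<in> sublevel_complex x n t \<longleftrightarrow> \<sigma> \<in> line_complex \<and> (\<forall>i\<in>\<sigma>. sublevel_vertex x n t i)"
proof (cases "\<sigma> \<in> line_complex")
  case True
  then have "finite \<sigma>" "\<sigma> \<noteq> {}" by (auto simp: line_complex_def)
  moreover have "padded x n i \<le> ereal t \<longleftrightarrow> sublevel_vertex x n t i" for i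
    by (auto simp: padded_def sublevel_vertex_def)
  ultimately show ?thesis using True by (simp add: sublevel_complex_def)
qed (simp add: sublevel_complex_def)

lemma down_closed_sublevel: "down_closed (sublevel_complex x n t)"
  unfolding down_closed_def
proof (intro ballI allI impI)
  fix \<sigma> \<tau> :: "nat set"
  assume s: "\<sigma> \<in> sublevel_complex x n t" and t: "\<tau> \<noteq> {} \<and> \<tau> \<subseteq> \<sigma>"
  have "\<tau> \<in> line_complex"
  proof -
    obtain i where "\<sigma> = {i} \<or> \<sigma> = {i, Suc i}"
      using s unfolding sublevel_complex_iff line_complex_def by blast
    then have "\<tau> = {i} \<or> \<tau> = {Suc i} \<or> \<tau> = {i, Suc i}" using t by blast
    then show ?thesis unfolding line_complex_def by blast
  qed
  then show "\<tau> \<in> sublevel_complex x n t"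
    using s t unfolding sublevel_complex_iff by blast
qed

lemma sublevel_mono: "s \<le> t \<Longrightarrow> sublevel_complex x n s \<subseteq> sublevel_complex x n t"
  unfolding subset_iff sublevel_complex_iff sublevel_vertex_def by auto

lemma vertex_chain_in_chain_group: "sublevel_vertex x n t i \<Longrightarrow> vertex_chain i \<in> carrier (chain_group 0 (sublevel_complex x n t))"
  unfolding carrier_chain_group sublevel_complex_iff
  by (auto simp: vertex_chain_def line_complex_def split: if_splits)

lemma edge_boundary: "boundary (\<lambda>\<sigma>. if \<sigma> = {j, Suc j} then 1 else 0) = (\<lambda>\<sigma>. vertex_chain j \<sigma> + vertex_chain (Suc j) \<sigma>)"
  (is "boundary ?e = _")
proof
  fix \<tau> :: "nat set"
  show "boundary ?e \<tau> = vertex_chain j \<tau> + vertex_chain (Suc j) \<tau>"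
  proof (cases "\<tau> = {}")
    case True
    then show ?thesis by (simp add: boundary_def vertex_chain_def)
  next
    case False
    let ?A = "{\<sigma> \<in> {{j, Suc j}}. \<tau> \<subset> \<sigma> \<and> card \<sigma> = Suc (card \<tau>)}"
    have eq: "boundary ?e \<tau> = sum ?e ?A"
      using False by (intro boundary_eq_sum) auto
    show ?thesis
    proof (cases "\<tau> = {j} \<or> \<tau> = {Suc j}")
      case True
      then have "\<tau> \<subset> {j, Suc j} \<and> card {j, Suc j} = Suc (card \<tau>)"
        by (elim disjE; hypsubst; simp add: psubset_eq doubleton_eq_iff)
      then have "?A = {{j, Suc j}}" by (auto simp only: mem_Collect_eq singleton_iff)
      then have "boundary ?e \<tau> = 1" unfolding eq by simp
      then show ?thesis using True by (auto simp: vertex_chain_def)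
    next
      case no: False
      have "\<not> \<tau> \<subset> {j, Suc j}"
      proof
        assume "\<tau> \<subset> {j, Suc j}"
        then have "\<tau> \<in> Pow {j, Suc j}" "\<tau> \<noteq> {j, Suc j}" by blast+
        then show False using no False by (simp add: Pow_insert)
      qed
      then have "?A = {}" by blast
      then have "boundary ?e \<tau> = 0" unfolding eq by (simp only: sum.empty)
      then show ?thesis using no by (auto simp: vertex_chain_def)
    qed
  qed
qed

text \<open>Telescoping: the edges along the way add up to a chain whose boundary is the two end points.\<close>

lemma path_boundary:
  assumes "i \<le> j" "\<And>k. k \<in> {i..j} \<Longrightarrow> sublevel_vertex x n t k"
  shows "(\<lambda>\<sigma>. vertex_chain i \<sigma> + vertex_chain j \<sigma>) \<in> boundaries 0 (sublevel_complex x n t)"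
  using assms
proof (induction j rule: dec_induct)
  case base
  then show ?case using boundaries_zero by simp
next
  case (step j)
  have "(\<lambda>\<sigma>. if \<sigma> = {j, Suc j} then 1 else 0) \<in> carrier (chain_group (Suc 0) (sublevel_complex x n t))"
    using step unfolding carrier_chain_group sublevel_complex_iff
    by (auto simp: line_complex_def split: if_splits)
  then have "(\<lambda>\<sigma>. vertex_chain j \<sigma> + vertex_chain (Suc j) \<sigma>) \<in> boundaries 0 (sublevel_complex x n t)"
    unfolding boundaries_def edge_boundary[symmetric] by (rule imageI)
  moreover have "(\<lambda>\<sigma>. vertex_chain i \<sigma> + vertex_chain j \<sigma>) \<in> boundaries 0 (sublevel_complex x n t)"
    using step by auto
  ultimately have "(\<lambda>\<sigma>. (vertex_chain i \<sigma> + vertex_chain j \<sigma>) + (vertex_chain j \<sigma> + vertex_chain (Suc j) \<sigma>)) \<in> boundaries 0 (sublevel_complex x n t)"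
    by (rule boundaries_add[rotated])
  then show ?case by (simp add: add.assoc)
qed

lemma connected_boundary:
  assumes "i \<in> {1..n}" "j \<in> {1..n}" "path_max x i j \<le> t"
  shows "(\<lambda>\<sigma>. vertex_chain i \<sigma> + vertex_chain j \<sigma>) \<in> boundaries 0 (sublevel_complex x n t)"
proof (cases "i \<le> j")
  case True
  then show ?thesis using assms unfolding path_max_le_iff
    by (intro path_boundary) (auto simp: sublevel_vertex_def)
next
  case False
  then have "(\<lambda>\<sigma>. vertex_chain j \<sigma> + vertex_chain i \<sigma>) \<in> boundaries 0 (sublevel_complex x n t)"
    using assms unfolding path_max_le_iff by (intro path_boundary) (auto simp: sublevel_vertex_def)
  then show ?thesis by (simp add: add.commute)
qed

definition component :: "(nat \<Rightarrow> real) \<Rightarrow> nat \<Rightarrow> real \<Rightarrow> nat \<Rightarrow> nat set" where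
  "component x n t i = {j\<in>{1..n}. path_max x i j \<le> t}"

lemma finite_component [simp]: "finite (component x n t i)"
  by (simp add: component_def)

text \<open>The coefficient sum over a component is the functional that detects homology: an edge has both or none of
its end points in a component, so it contributes an even number of times.\<close>

lemma sum_component_boundary:
  assumes "c \<in> boundaries 0 (sublevel_complex x n t)"
  shows "(\<Sum>j\<in>component x n t i. c {j}) = 0"
proof -
  let ?R = "component x n t i"
  obtain e where e: "e \<in> carrier (chain_group (Suc 0) (sublevel_complex x n t))" "c = boundary e"
    using assms unfolding boundaries_def by blast
  define S where "S = {\<sigma>. e \<sigma> \<noteq> 0}"
  have S: "finite S" "\<And>\<sigma>. \<sigma> \<in> S \<Longrightarrow> \<sigma> \<in> sublevel_complex x n t \<and> card \<sigma> = 2"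
    using e(1) unfolding carrier_chain_group S_def by auto
  have "c {j} = (\<Sum>\<sigma>\<in>S. if j \<in> \<sigma> then e \<sigma> else 0)" for j
  proof -
    have "c {j} = (\<Sum>\<sigma>\<in>{\<sigma>\<in>S. {j} \<subset> \<sigma> \<and> card \<sigma> = Suc (card {j})}. e \<sigma>)"
      unfolding e(2) using S(1) by (intro boundary_eq_sum) (auto simp: S_def)
    also have "{\<sigma>\<in>S. {j} \<subset> \<sigma> \<and> card \<sigma> = Suc (card {j})} = {\<sigma>\<in>S. j \<in> \<sigma>}"
      using S(2) by fastforce
    also have "(\<Sum>\<sigma>\<in>{\<sigma>\<in>S. j \<in> \<sigma>}. e \<sigma>) = (\<Sum>\<sigma>\<in>S. if j \<in> \<sigma> then e \<sigma> else 0)"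
      using S(1) by (rule sum.inter_filter)
    finally show ?thesis .
  qed
  then have "(\<Sum>j\<in>?R. c {j}) = (\<Sum>j\<in>?R. \<Sum>\<sigma>\<in>S. if j \<in> \<sigma> then e \<sigma> else 0)" by simp
  also have "\<dots> = (\<Sum>\<sigma>\<in>S. \<Sum>j\<in>?R. if j \<in> \<sigma> then e \<sigma> else 0)" by (rule sum.swap)
  also have "\<dots> = (\<Sum>\<sigma>\<in>S. 0)"
  proof (rule sum.cong[OF refl])
    fix \<sigma> assume s: "\<sigma> \<in> S"
    from S(2)[OF this] have "\<sigma> \<in> line_complex" "card \<sigma> = 2" and al: "\<forall>k\<in>\<sigma>. sublevel_vertex x n t k"
      unfolding sublevel_complex_iff by auto
    then obtain k where k: "\<sigma> = {k, Suc k}" unfolding line_complex_def by auto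
    have "path_max x k (Suc k) \<le> t"
    proof -
      have "{min k (Suc k)..max k (Suc k)} = {k, Suc k}" by auto
      then show ?thesis using al unfolding path_max_le_iff k by (simp add: sublevel_vertex_def)
    qed
    then have iff: "k \<in> ?R \<longleftrightarrow> Suc k \<in> ?R"
      using al path_max_trans[of x i k t "Suc k"] path_max_trans[of x i "Suc k" t k]
      unfolding k component_def by (auto simp: sublevel_vertex_def path_max_commute)
    have "(\<Sum>j\<in>?R. if j \<in> \<sigma> then e \<sigma> else 0) = (\<Sum>j\<in>{j\<in>?R. j \<in> \<sigma>}. e \<sigma>)"
      by (rule sum.inter_filter[symmetric]) simp
    also have "\<dots> = 0"
    proof (cases "k \<in> ?R")
      case True
      then have "{j\<in>?R. j \<in> \<sigma>} = {k, Suc k}" using iff unfolding k by blast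
      then show ?thesis by simp
    next
      case False
      then have "{j\<in>?R. j \<in> \<sigma>} = {}" using iff unfolding k by blast
      then show ?thesis by (simp only: sum.empty)
    qed
    finally show "(\<Sum>j\<in>?R. if j \<in> \<sigma> then e \<sigma> else 0) = 0" .
  qed
  finally show ?thesis by simp
qed

text \<open>The cycle carried by the bar of \<open>i\<close>. The vertex \<open>i\<close> alone would not do: when its component merges, the
class of \<open>i\<close> becomes that of an older vertex and not zero. Adding the elder makes the class vanish
exactly from \<open>death x n i\<close> on.\<close>

definition bar_cycle :: "(nat \<Rightarrow> real) \<Rightarrow> nat \<Rightarrow> nat \<Rightarrow> nat set \<Rightarrow> bit" where
  "bar_cycle x n i = (\<lambda>\<sigma>. vertex_chain i \<sigma> + (if death x n i = \<infinity> then 0 else vertex_chain (elder x n i) \<sigma>))"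

lemma bar_cycle_in_chain_group:
  assumes "sublevel_vertex x n t i"
  shows "bar_cycle x n i \<in> carrier (chain_group 0 (sublevel_complex x n t))"
proof (cases "death x n i = \<infinity>")
  case True
  then show ?thesis using vertex_chain_in_chain_group[OF assms] by (simp add: bar_cycle_def)
next
  case False
  have "sublevel_vertex x n t (elder x n i)"
    using elder[OF False] older_le[of x "elder x n i" i] assms by (simp add: sublevel_vertex_def)
  then show ?thesis using False vertex_chain_in_chain_group assms
    by (simp add: bar_cycle_def chain_add_closed)
qed

lemma bar_cycle_boundary:
  assumes "i \<in> {1..n}" "death x n i \<le> ereal t"
  shows "bar_cycle x n i \<in> boundaries 0 (sublevel_complex x n t)"
proof -
  have ne: "death x n i \<noteq> \<infinity>" using assms(2) by auto
  then show ?thesis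
    using connected_boundary[OF assms(1) elder(1)[OF ne], of x t] elder(3)[OF ne] assms(2)
    by (simp add: bar_cycle_def)
qed

definition bar_chain :: "(nat \<Rightarrow> real) \<Rightarrow> nat \<Rightarrow> (nat \<Rightarrow> bit) \<Rightarrow> nat set \<Rightarrow> bit" where
  "bar_chain x n v = (\<lambda>\<sigma>. \<Sum>i\<in>bars x n. v i * bar_cycle x n i \<sigma>)"

lemma bar_chain_add:
  "bar_chain x n (\<lambda>i. v i + w i) = (\<lambda>\<sigma>. bar_chain x n v \<sigma> + bar_chain x n w \<sigma>)"
  by (simp add: bar_chain_def distrib_right sum.distrib)

lemma bar_chain_single:
  assumes "i \<in> bars x n"
  shows "bar_chain x n (\<lambda>j. if j = i then 1 else 0) = bar_cycle x n i"
proof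
  fix \<sigma>
  have "bar_chain x n (\<lambda>j. if j = i then 1 else 0) \<sigma> =
      (\<Sum>j\<in>bars x n. if j = i then bar_cycle x n j \<sigma> else 0)"
    unfolding bar_chain_def by (intro sum.cong) auto
  then show "bar_chain x n (\<lambda>j. if j = i then 1 else 0) \<sigma> = bar_cycle x n i \<sigma>"
    using assms by simp
qed

text \<open>Over the field with two elements a linear combination is a finite sum, so any set of chains that
is closed under addition and contains the cycles used contains the combination.\<close>

lemma bar_chain_closed:
  assumes zero: "(\<lambda>_. 0) \<in> H" and add: "\<And>a b. a \<in> H \<Longrightarrow> b \<in> H \<Longrightarrow> (\<lambda>\<sigma>. a \<sigma> + b \<sigma>) \<in> H"
    and mem: "\<And>i. i \<in> bars x n \<Longrightarrow> v i \<noteq> 0 \<Longrightarrow> bar_cycle x n i \<in> H"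
  shows "bar_chain x n v \<in> H"
proof -
  have "(\<lambda>\<sigma>. \<Sum>i\<in>A. v i * bar_cycle x n i \<sigma>) \<in> H" if "A \<subseteq> bars x n" for A
  proof -
    have "finite A" using that finite_bars finite_subset by blast
    then show ?thesis using that
    proof (induction A rule: finite_induct)
      case empty
      then show ?case using zero by simp
    next
      case (insert i A)
      have "(\<lambda>\<sigma>. v i * bar_cycle x n i \<sigma>) \<in> H"
      proof (cases "v i = 0")
        case True
        then show ?thesis using zero by simp
      next
        case False
        then have "v i = 1" by (cases "v i") simp_all
        then show ?thesis using mem[of i] insert.prems by simp
      qed
      then show ?case using insert add by simp
    qed
  qed
  then show ?thesis unfolding bar_chain_def by blast
qed

lemma bar_chain_in_chain_group:
  assumes "\<And>i. i \<in> bars x n \<Longrightarrow> v i \<noteq> 0 \<Longrightarrow> x i \<le> t"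
  shows "bar_chain x n v \<in> carrier (chain_group 0 (sublevel_complex x n t))"
proof (rule bar_chain_closed)
  show "(\<lambda>_. 0) \<in> carrier (chain_group 0 (sublevel_complex x n t))"
    by (simp add: carrier_chain_group)
  show "bar_cycle x n i \<in> carrier (chain_group 0 (sublevel_complex x n t))"
    if "i \<in> bars x n" "v i \<noteq> 0" for i
    using that assms by (intro bar_cycle_in_chain_group) (auto simp: sublevel_vertex_def bars_def)
qed (rule chain_add_closed)

lemma bar_chain_boundary:
  assumes "\<And>i. i \<in> bars x n \<Longrightarrow> v i \<noteq> 0 \<Longrightarrow> death x n i \<le> ereal t"
  shows "bar_chain x n v \<in> boundaries 0 (sublevel_complex x n t)"
proof (rule bar_chain_closed[OF boundaries_zero boundaries_add])
  show "bar_cycle x n i \<in> boundaries 0 (sublevel_complex x n t)"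
    if "i \<in> bars x n" "v i \<noteq> 0" for i
    using that assms by (intro bar_cycle_boundary) (auto simp: bars_def)
qed

definition bar_alive :: "(nat \<Rightarrow> real) \<Rightarrow> nat \<Rightarrow> real \<Rightarrow> nat \<Rightarrow> bool" where
  "bar_alive x n t i \<longleftrightarrow> x i \<le> t \<and> ereal t < death x n i"

lemma sum_vertex_chain_component:
  "(\<Sum>j\<in>component x n t i. vertex_chain k {j}) = (if k \<in> component x n t i then 1 else 0)"
proof -
  have "(\<Sum>j\<in>component x n t i. vertex_chain k {j}) = (\<Sum>j\<in>component x n t i. if j = k then 1 else 0)"
    by (intro sum.cong) (auto simp: vertex_chain_def)
  then show ?thesis by simp
qed

text \<open>The death level bounds from below the level of connection with any older vertex.\<close>

lemma component_not_older:
  assumes "bar_alive x n t i" "j \<in> component x n t i"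
  shows "\<not> older x j i"
proof
  assume "older x j i"
  then have "death x n i \<le> ereal (path_max x i j)"
    using assms(2) by (intro death_le) (auto simp: component_def)
  also have "\<dots> \<le> ereal t" using assms(2) by (simp add: component_def)
  finally show False using assms(1) by (auto simp: bar_alive_def)
qed

text \<open>Triangularity with respect to age. Among the bars that occur take the youngest, \<open>i\<close>, and sum
coefficients over its component. The cycle of \<open>i\<close> contributes 1, as its elder lies outside. Another
occurring cycle, of an older \<open>j\<close>, contributes 0, because \<open>i\<close> is the oldest vertex of its own
component and both \<open>j\<close> and the elder of \<open>j\<close> are older still.\<close>

lemma bar_chain_independent:
  assumes bar_alive: "\<And>i. i \<in> bars x n \<Longrightarrow> v i \<noteq> 0 \<Longrightarrow> bar_alive x n t i"
    and bd: "bar_chain x n v \<in> boundaries 0 (sublevel_complex x n t)"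
    and k: "k \<in> bars x n"
  shows "v k = 0"
proof (rule ccontr)
  assume "v k \<noteq> 0"
  define A where "A = {i\<in>bars x n. v i \<noteq> 0}"
  have "finite A" "A \<noteq> {}" using k \<open>v k \<noteq> 0\<close> by (auto simp: A_def)
  then obtain i where i: "i \<in> A" and max: "\<And>j. j \<in> A \<Longrightarrow> \<not> older x i j"
    using finite_older_maximal by metis
  let ?R = "component x n t i"
  have li: "bar_alive x n t i" using i bar_alive by (simp add: A_def)
  have elder_notin: "elder x n j \<notin> ?R" if j: "j \<in> A" and fin: "death x n j \<noteq> \<infinity>" for j
  proof
    assume "elder x n j \<in> ?R"
    then have "\<not> older x (elder x n j) i" using li component_not_older by blast
    then have "elder x n j = i \<or> older x i (elder x n j)" using older_linear by blast
    then have "older x i j" using elder(2)[OF fin] older_trans by blast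
    then show False using max[OF j] by blast
  qed
  have cyc: "(\<Sum>l\<in>?R. bar_cycle x n j {l}) = (if j = i then 1 else 0)" if j: "j \<in> A" for j
  proof -
    have "j \<in> ?R \<longleftrightarrow> j = i"
    proof
      assume "j \<in> ?R"
      then have "\<not> older x j i" using li component_not_older by blast
      then show "j = i" using max[OF j] older_linear by blast
    next
      assume "j = i"
      then show "j \<in> ?R" using i li by (simp add: component_def A_def bars_def bar_alive_def)
    qed
    then show ?thesis using elder_notin[OF j]
      by (cases "death x n j = \<infinity>") (simp_all add: bar_cycle_def sum.distrib sum_vertex_chain_component)
  qed
  have "(\<Sum>l\<in>?R. bar_chain x n v {l}) = (\<Sum>j\<in>bars x n. \<Sum>l\<in>?R. v j * bar_cycle x n j {l})"
    unfolding bar_chain_def by (rule sum.swap)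
  also have "\<dots> = (\<Sum>j\<in>bars x n. v j * (\<Sum>l\<in>?R. bar_cycle x n j {l}))"
    by (simp add: sum_distrib_left)
  also have "\<dots> = (\<Sum>j\<in>bars x n. if j = i then v i else 0)"
  proof (rule sum.cong[OF refl])
    fix j assume "j \<in> bars x n"
    then show "v j * (\<Sum>l\<in>?R. bar_cycle x n j {l}) = (if j = i then v i else 0)"
      using cyc[of j] i by (cases "v j = 0") (auto simp: A_def)
  qed
  also have "\<dots> = v i" using i by (simp add: A_def)
  finally have "v i = 0" using sum_component_boundary[OF bd] by simp
  then show False using i by (simp add: A_def)
qed

text \<open>Induction on age: a vertex is homologous to its elder up to its own bar cycle, and the bar cycle
is either among the living ones or already a boundary.\<close>

lemma bar_chain_spans_vertex:
  assumes "sublevel_vertex x n t j"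
  shows "\<exists>v. (\<forall>i. v i \<noteq> 0 \<longrightarrow> bar_alive x n t i) \<and>
    (\<lambda>\<sigma>. vertex_chain j \<sigma> + bar_chain x n v \<sigma>) \<in> boundaries 0 (sublevel_complex x n t)"
proof (rule ccontr)
  define good where "good j \<longleftrightarrow> (\<exists>v. (\<forall>i. v i \<noteq> 0 \<longrightarrow> bar_alive x n t i) \<and>
    (\<lambda>\<sigma>. vertex_chain j \<sigma> + bar_chain x n v \<sigma>) \<in> boundaries 0 (sublevel_complex x n t))" for j
  assume "\<not> ?thesis"
  then have ne: "{j. sublevel_vertex x n t j \<and> \<not> good j} \<noteq> {}" using assms unfolding good_def by blast
  have fin: "finite {j. sublevel_vertex x n t j \<and> \<not> good j}"
    by (rule finite_subset[of _ "{1..n}"]) (auto simp: sublevel_vertex_def)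
  obtain j where j0: "j \<in> {j. sublevel_vertex x n t j \<and> \<not> good j}"
    and min0: "\<And>i. i \<in> {j. sublevel_vertex x n t j \<and> \<not> good j} \<Longrightarrow> \<not> older x i j"
    using finite_older_minimal[OF fin ne, of x] by auto
  have j: "sublevel_vertex x n t j" "\<not> good j" using j0 by simp_all
  have min: "good i" if "sublevel_vertex x n t i" "older x i j" for i using min0[of i] that by blast
  have jn: "j \<in> {1..n}" "x j \<le> t" using j(1) by (auto simp: sublevel_vertex_def)
  show False
  proof (cases "death x n j = \<infinity>")
    case True
    then have "bar_alive x n t j" "j \<in> bars x n" using jn by (auto simp: bar_alive_def bars_def)
    then have "good j" unfolding good_def
      using True boundaries_zero bar_chain_single[of j x n]
      by (intro exI[of _ "\<lambda>i. if i = j then 1 else 0"]) (auto simp: bar_cycle_def)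
    then show False using j(2) by blast
  next
    case False
    have "sublevel_vertex x n t (elder x n j)"
      using elder[OF False] older_le[of x "elder x n j" j] jn by (simp add: sublevel_vertex_def)
    then obtain v where v: "\<forall>i. v i \<noteq> 0 \<longrightarrow> bar_alive x n t i"
      "(\<lambda>\<sigma>. vertex_chain (elder x n j) \<sigma> + bar_chain x n v \<sigma>) \<in> boundaries 0 (sublevel_complex x n t)"
      using min elder(2)[OF False] unfolding good_def by blast
    show False
    proof (cases "death x n j \<le> ereal t")
      case True
      have "(\<lambda>\<sigma>. vertex_chain j \<sigma> + vertex_chain (elder x n j) \<sigma>) \<in> boundaries 0 (sublevel_complex x n t)"
        using elder[OF False] True jn by (intro connected_boundary) auto
      from boundaries_add[OF this v(2)]
      have "(\<lambda>\<sigma>. vertex_chain j \<sigma> + bar_chain x n v \<sigma>) \<in> boundaries 0 (sublevel_complex x n t)"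
        by (simp add: add.assoc)
      then show False using j(2) v(1) unfolding good_def by blast
    next
      case nle: False
      have lj: "bar_alive x n t j" using nle jn by (simp add: bar_alive_def)
      have jb: "j \<in> bars x n" using nle jn
        by (simp add: bars_def) (meson dual_order.strict_trans1 ereal_less_eq(3) not_le)
      define w where "w = (\<lambda>i. (if i = j then 1 else 0) + v i)"
      have "\<forall>i. w i \<noteq> 0 \<longrightarrow> bar_alive x n t i" using v(1) lj by (auto simp: w_def)
      moreover have "(\<lambda>\<sigma>. vertex_chain j \<sigma> + bar_chain x n w \<sigma>) =
          (\<lambda>\<sigma>. vertex_chain (elder x n j) \<sigma> + bar_chain x n v \<sigma>)"
        unfolding w_def bar_chain_add bar_chain_single[OF jb] using False
        by (simp add: bar_cycle_def add.assoc)
      ultimately show False using j(2) v(2) unfolding good_def by auto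
    qed
  qed
qed

lemma bar_chain_spans:
  assumes c: "c \<in> carrier (chain_group 0 (sublevel_complex x n t))"
  shows "\<exists>v. (\<forall>i. v i \<noteq> 0 \<longrightarrow> bar_alive x n t i) \<and>
    (\<lambda>\<sigma>. c \<sigma> + bar_chain x n v \<sigma>) \<in> boundaries 0 (sublevel_complex x n t)"
proof -
  have *: "\<exists>v. (\<forall>i. v i \<noteq> 0 \<longrightarrow> bar_alive x n t i) \<and>
    (\<lambda>\<sigma>. (\<Sum>j\<in>S. vertex_chain j \<sigma>) + bar_chain x n v \<sigma>) \<in> boundaries 0 (sublevel_complex x n t)"
    if "finite S" "\<forall>j\<in>S. sublevel_vertex x n t j" for S
    using that
  proof (induction S rule: finite_induct)
    case empty
    then show ?case
      by (intro exI[of _ "\<lambda>_. 0"]) (simp add: bar_chain_def boundaries_zero)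
  next
    case (insert j S)
    then obtain v w where v: "\<forall>i. v i \<noteq> 0 \<longrightarrow> bar_alive x n t i"
        "(\<lambda>\<sigma>. (\<Sum>j\<in>S. vertex_chain j \<sigma>) + bar_chain x n v \<sigma>) \<in> boundaries 0 (sublevel_complex x n t)"
      and w: "\<forall>i. w i \<noteq> 0 \<longrightarrow> bar_alive x n t i"
        "(\<lambda>\<sigma>. vertex_chain j \<sigma> + bar_chain x n w \<sigma>) \<in> boundaries 0 (sublevel_complex x n t)"
      using bar_chain_spans_vertex[of x n t j] by auto
    have "\<forall>i. v i + w i \<noteq> 0 \<longrightarrow> bar_alive x n t i" using v(1) w(1) by (metis add_0)
    moreover have "(\<lambda>\<sigma>. (\<Sum>j\<in>insert j S. vertex_chain j \<sigma>) + bar_chain x n (\<lambda>i. v i + w i) \<sigma>)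
        \<in> boundaries 0 (sublevel_complex x n t)"
      using boundaries_add[OF v(2) w(2)] insert.hyps by (simp add: bar_chain_add add_ac)
    ultimately show ?case by (intro exI[of _ "\<lambda>i. v i + w i"] conjI)
  qed
  define S where "S = {j. c {j} \<noteq> 0}"
  have al: "\<forall>j\<in>S. sublevel_vertex x n t j"
  proof
    fix j assume "j \<in> S"
    then have "{j} \<in> sublevel_complex x n t" using c unfolding carrier_chain_group S_def by blast
    then show "sublevel_vertex x n t j" unfolding sublevel_complex_iff by blast
  qed
  then have finS: "finite S" by (intro finite_subset[of S "{1..n}"]) (auto simp: sublevel_vertex_def)
  have "c = (\<lambda>\<sigma>. \<Sum>j\<in>S. vertex_chain j \<sigma>)"
  proof
    fix \<sigma>
    show "c \<sigma> = (\<Sum>j\<in>S. vertex_chain j \<sigma>)"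
    proof (cases "card \<sigma> = 1")
      case True
      then obtain k where k: "\<sigma> = {k}" by (auto simp: card_1_singleton_iff)
      have "(\<Sum>j\<in>S. vertex_chain j \<sigma>) = (\<Sum>j\<in>S. if j = k then 1 else 0)"
        by (intro sum.cong) (auto simp: vertex_chain_def k)
      also have "\<dots> = (if k \<in> S then 1 else 0)" using finS by simp
      also have "\<dots> = c \<sigma>" unfolding k S_def by (cases "c {k}") auto
      finally show ?thesis by simp
    next
      case False
      then have "c \<sigma> = 0" using c unfolding carrier_chain_group by auto
      moreover have "(\<Sum>j\<in>S. vertex_chain j \<sigma>) = 0"
        using False by (intro sum.neutral) (auto simp: vertex_chain_def)
      ultimately show ?thesis by simp
    qed
  qed
  with *[OF finS al] show ?thesis by simp
qed

section \<open>Barcode modules and their ranks\<close>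

text \<open>One index per occurrence of a point, as in the direct sum that defines barcode modules.\<close>

definition bar_index :: "'p multiset \<Rightarrow> ('p \<times> nat) set" where
  "bar_index D = {(p, k). k < count D p}"

lemma finite_bar_index: "finite (bar_index D)"
proof -
  have "bar_index D \<subseteq> (\<Union>p\<in>set_mset D. {p} \<times> {..<count D p})"
    by (auto simp: bar_index_def) (metis count_greater_zero_iff gr_zeroI not_less_zero)
  then show ?thesis by (rule finite_subset) auto
qed

lemma interval_module_carrier:
  "v \<in> carrier (fst (interval_module p) t) \<longleftrightarrow> (v \<noteq> 0 \<longrightarrow> fst p \<le> ereal t \<and> ereal t < snd p)"
  by (simp add: interval_module_def split_beta)

lemma group_interval_module: "group (fst (interval_module p) t)"
proof (rule groupI)
  fix v assume "v \<in> carrier (fst (interval_module p) t)"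
  then show "\<exists>w\<in>carrier (fst (interval_module p) t).
      w \<otimes>\<^bsub>fst (interval_module p) t\<^esub> v = \<one>\<^bsub>fst (interval_module p) t\<^esub>"
    by (intro bexI[of _ v]) (simp add: interval_module_def split_beta)
qed (auto simp: interval_module_def split_beta add.assoc)

lemma barcode_module_space:
  "fst (barcode_module D) t = sum_group (bar_index D) (\<lambda>q. fst (interval_module (fst q)) t)"
  by (simp add: barcode_module_def direct_sum_module_def bar_index_def split_beta)

lemma barcode_module_map:
  "snd (barcode_module D) s t v = (\<lambda>q\<in>bar_index D.
     if fst (fst q) \<le> ereal s \<and> ereal t < snd (fst q) then v q else 0)"
  by (simp add: barcode_module_def direct_sum_module_def bar_index_def interval_module_def
      split_beta cong: restrict_cong)

lemma barcode_module_carrier: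
  "v \<in> carrier (fst (barcode_module D) t) \<longleftrightarrow> v \<in> extensional (bar_index D) \<and>
     (\<forall>q\<in>bar_index D. v q \<noteq> 0 \<longrightarrow> fst (fst q) \<le> ereal t \<and> ereal t < snd (fst q))"
  unfolding barcode_module_space
  by (subst carrier_sum_group)
    (auto simp: group_interval_module interval_module_carrier PiE_iff
      intro: finite_subset[OF _ finite_bar_index])

lemma group_barcode_module: "group (fst (barcode_module D) t)"
  unfolding barcode_module_space by (intro sum_group group_interval_module)

lemma mult_barcode_module:
  "v \<otimes>\<^bsub>fst (barcode_module D) t\<^esub> w = (\<lambda>q\<in>bar_index D. v q + w q)"
  unfolding barcode_module_space mult_sum_group
  by (rule restrict_ext) (simp add: interval_module_def split_beta)

lemma barcode_module_map_closed:
  assumes "s \<le> t" "v \<in> carrier (fst (barcode_module D) s)"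
  shows "snd (barcode_module D) s t v \<in> carrier (fst (barcode_module D) t)"
  using assms unfolding barcode_module_carrier barcode_module_map
  by (auto intro: order_trans)

definition pers_rank :: "(ereal \<times> ereal) multiset \<Rightarrow> real \<Rightarrow> real \<Rightarrow> nat" where
  "pers_rank D s t = card {q\<in>bar_index D. fst (fst q) \<le> ereal s \<and> ereal t < snd (fst q)}"

text \<open>Spaces are bare groups here, so the cardinality of an image stands in for the rank of a map.\<close>

lemma card_image_barcode_module:
  assumes "s \<le> t"
  shows "card (snd (barcode_module D) s t ` carrier (fst (barcode_module D) s)) = 2 ^ pers_rank D s t"
proof -
  let ?J = "bar_index D"
  let ?A = "{q\<in>?J. fst (fst q) \<le> ereal s \<and> ereal t < snd (fst q)}"
  let ?F = "\<lambda>q. if q \<in> ?A then UNIV else {0::bit}"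
  have "snd (barcode_module D) s t ` carrier (fst (barcode_module D) s) = PiE ?J ?F"
  proof
    show "snd (barcode_module D) s t ` carrier (fst (barcode_module D) s) \<subseteq> PiE ?J ?F"
      by (auto simp: barcode_module_map PiE_iff)
    show "PiE ?J ?F \<subseteq> snd (barcode_module D) s t ` carrier (fst (barcode_module D) s)"
    proof
      fix v assume v: "v \<in> PiE ?J ?F"
      then have ext: "v \<in> extensional ?J" by (simp add: PiE_iff)
      have z: "v q = 0" if "q \<in> ?J" "q \<notin> ?A" for q
        using that PiE_mem[OF v that(1)] by (simp split: if_splits)
      have "v \<in> carrier (fst (barcode_module D) s)"
        unfolding barcode_module_carrier
      proof (intro conjI ballI impI ext)
        fix q assume q: "q \<in> ?J" "v q \<noteq> 0"
        then have "q \<in> ?A" using z by blast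
        moreover have "ereal s \<le> ereal t" using assms by simp
        ultimately show "fst (fst q) \<le> ereal s" "ereal s < snd (fst q)"
          using le_less_trans[of "ereal s" "ereal t" "snd (fst q)"] by simp_all
      qed
      moreover have "v = snd (barcode_module D) s t v"
        unfolding barcode_module_map
      proof (rule extensionalityI[OF ext])
        fix q assume "q \<in> ?J"
        then show "v q = (\<lambda>q\<in>bar_index D.
            if fst (fst q) \<le> ereal s \<and> ereal t < snd (fst q) then v q else 0) q"
          using z[of q] by simp
      qed simp
      ultimately show "v \<in> snd (barcode_module D) s t ` carrier (fst (barcode_module D) s)"
        by (intro image_eqI)
    qed
  qed
  then have "card (snd (barcode_module D) s t ` carrier (fst (barcode_module D) s))
      = (\<Prod>q\<in>?J. card (?F q))"
    by (simp only: card_PiE[OF finite_bar_index])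
  also have "\<dots> = (\<Prod>q\<in>?J. if q \<in> ?A then 2 else 1)"
  proof (intro prod.cong refl)
    have "(UNIV :: bit set) = {0, 1}"
      by (auto) (metis bit.exhaust)
    then have "card (UNIV :: bit set) = card {0, 1 :: bit}" by (rule arg_cong)
    then have "card (UNIV :: bit set) = 2" by simp
    then show "card (?F q) = (if q \<in> ?A then 2 else 1)" for q by simp
  qed
  also have "\<dots> = (\<Prod>q\<in>?A. 2)"
    by (subst prod.inter_filter[OF finite_bar_index]) (rule prod.cong, auto)
  also have "\<dots> = 2 ^ pers_rank D s t" by (simp add: pers_rank_def)
  finally show ?thesis .
qed

text \<open>An isomorphism of persistence modules carries the image of a structure map onto that of its
counterpart.\<close>

lemma card_image_pers_iso:
  assumes iso: "pers_iso V (barcode_module D)" and "s \<le> t"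
    and closed: "\<And>v. v \<in> carrier (fst V s) \<Longrightarrow> snd V s t v \<in> carrier (fst V t)"
  shows "card (snd V s t ` carrier (fst V s)) = 2 ^ pers_rank D s t"
proof -
  obtain \<theta> where th: "\<And>t. \<theta> t \<in> iso (fst V t) (fst (barcode_module D) t)"
    and nat: "\<And>s t v. s \<le> t \<Longrightarrow> v \<in> carrier (fst V s) \<Longrightarrow>
       \<theta> t (snd V s t v) = snd (barcode_module D) s t (\<theta> s v)"
    using iso unfolding pers_iso_def by blast
  have bij: "bij_betw (\<theta> t) (carrier (fst V t)) (carrier (fst (barcode_module D) t))" for t
    using th by (simp add: iso_def)
  have "inj_on (\<theta> t) (snd V s t ` carrier (fst V s))"
    using bij_betw_imp_inj_on[OF bij] closed by (blast intro: inj_on_subset)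
  then have "card (snd V s t ` carrier (fst V s)) = card (\<theta> t ` snd V s t ` carrier (fst V s))"
    by (simp add: card_image)
  also have "\<theta> t ` snd V s t ` carrier (fst V s) = snd (barcode_module D) s t ` \<theta> s ` carrier (fst V s)"
    unfolding image_image using nat[OF \<open>s \<le> t\<close>] by (intro image_cong refl)
  also have "\<theta> s ` carrier (fst V s) = carrier (fst (barcode_module D) s)"
    using bij by (simp add: bij_betw_def)
  finally show ?thesis using card_image_barcode_module[OF \<open>s \<le> t\<close>] by simp
qed

lemma pers_rank_eq_size:
  "pers_rank D s t = size (filter_mset (\<lambda>p. fst p \<le> ereal s \<and> ereal t < snd p) D)"
proof -
  let ?P = "\<lambda>p. fst p \<le> ereal s \<and> ereal t < snd p"
  have "{q\<in>bar_index D. fst (fst q) \<le> ereal s \<and> ereal t < snd (fst q)}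
      = (SIGMA p:{p\<in>set_mset D. ?P p}. {..<count D p})"
    by (auto simp: bar_index_def) (metis count_greater_zero_iff gr_zeroI not_less_zero)
  then have "pers_rank D s t = (\<Sum>p\<in>{p\<in>set_mset D. ?P p}. count D p)"
    unfolding pers_rank_def by (simp add: card_SigmaI)
  also have "\<dots> = size (filter_mset ?P D)"
    by (simp add: size_multiset_overloaded_eq)
  finally show ?thesis .
qed

text \<open>Remove the common part of the two multisets. Among the remaining points take one, \<open>(b, d)\<close>, with \<open>b\<close>
minimal and then \<open>d\<close> maximal, and test at birth level \<open>b\<close> and a level just below \<open>d\<close>: no other
remaining point is counted there, so \<open>(b, d)\<close> would have to remain on both sides.\<close>

lemma pers_rank_determines:
  assumes D: "set_mset D \<subseteq> Delta" and D': "set_mset D' \<subseteq> Delta"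
    and eq: "\<And>s t. s \<le> t \<Longrightarrow> pers_rank D s t = pers_rank D' s t"
  shows "D = D'"
proof (rule ccontr)
  assume ne: "D \<noteq> D'"
  define E where "E = D - D'"
  define E' where "E' = D' - D"
  define P where "P s t p \<longleftrightarrow> fst p \<le> ereal s \<and> ereal t < snd p" for s t and p :: "ereal \<times> ereal"
  have DE: "D = E + D \<inter># D'" "D' = E' + D \<inter># D'"
    unfolding E_def E'_def by (auto simp: multiset_eq_iff)
  have disj: "set_mset E \<inter> set_mset E' = {}"
    unfolding E_def E'_def by (auto simp: in_diff_count)
  have eqE: "(\<exists>p\<in>#E. P s t p) \<longleftrightarrow> (\<exists>p\<in>#E'. P s t p)" if "s \<le> t" for s t
  proof -
    have "size (filter_mset (P s t) D) = size (filter_mset (P s t) D')"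
      using eq[OF that] unfolding pers_rank_eq_size P_def by simp
    moreover have "size (filter_mset (P s t) D) =
        size (filter_mset (P s t) E) + size (filter_mset (P s t) (D \<inter># D'))"
      using DE(1) by (metis filter_union_mset size_union)
    moreover have "size (filter_mset (P s t) D') =
        size (filter_mset (P s t) E') + size (filter_mset (P s t) (D \<inter># D'))"
      using DE(2) by (metis filter_union_mset size_union)
    ultimately have "size (filter_mset (P s t) E) = size (filter_mset (P s t) E')" by linarith
    then have "filter_mset (P s t) E = {#} \<longleftrightarrow> filter_mset (P s t) E' = {#}"
      by (metis size_eq_0_iff_empty)
    then have "set_mset (filter_mset (P s t) E) = {} \<longleftrightarrow> set_mset (filter_mset (P s t) E') = {}"
      by (simp only: set_mset_eq_empty_iff)
    then show ?thesis unfolding set_mset_filter by blast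
  qed
  define U where "U = set_mset E \<union> set_mset E'"
  have U: "finite U" "U \<noteq> {}" "U \<subseteq> Delta"
  proof -
    show "U \<noteq> {}"
    proof
      assume "U = {}"
      then have "E = {#}" "E' = {#}" unfolding U_def by auto
      then show False using DE ne by simp
    qed
    show "U \<subseteq> Delta" using D D' unfolding U_def E_def E'_def by (auto dest: in_diffD)
  qed (simp add: U_def)
  define b where "b = Min (fst ` U)"
  have b: "b \<in> fst ` U" "\<And>p. p \<in> U \<Longrightarrow> b \<le> fst p" using U unfolding b_def by auto
  define d where "d = Max (snd ` {p\<in>U. fst p = b})"
  have dU: "{p\<in>U. fst p = b} \<noteq> {}" using b by auto
  have d: "d \<in> snd ` {p\<in>U. fst p = b}" "\<And>p. p \<in> U \<Longrightarrow> fst p = b \<Longrightarrow> snd p \<le> d"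
    using U dU unfolding d_def by (auto intro!: Max_in)
  have bd: "(b, d) \<in> U" using d(1) by force
  then have "- \<infinity> < b" "b < d" using U(3) by (auto simp: Delta_def)
  then obtain s where s: "b = ereal s" by (cases b) auto
  \<comment> \<open>The next lower end point below \<open>d\<close>, or \<open>b\<close> if there is none.\<close>
  define e where "e = Max (insert b {c \<in> snd ` U. c < d})"
  have e: "b \<le> e" "e < d" "\<And>p. p \<in> U \<Longrightarrow> snd p < d \<Longrightarrow> snd p \<le> e"
  proof -
    have fin: "finite (insert b {c \<in> snd ` U. c < d})" using U by simp
    show "b \<le> e" "\<And>p. p \<in> U \<Longrightarrow> snd p < d \<Longrightarrow> snd p \<le> e"
      unfolding e_def using fin by (auto intro!: Max_ge)
    have "e \<in> insert b {c \<in> snd ` U. c < d}" unfolding e_def by (rule Max_in[OF fin]) simp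
    then show "e < d" using \<open>b < d\<close> by auto
  qed
  have "\<bar>e\<bar> \<noteq> \<infinity>" using e(1,2) s by (cases e) auto
  then obtain t where t: "e = ereal t" by (cases e) auto
  have st: "s \<le> t" using e(1) s t by simp
  have only: "p = (b, d)" if "p \<in> U" "P s t p" for p
  proof -
    have "fst p = b" using b(2)[OF that(1)] that(2) s by (simp add: P_def)
    moreover have "\<not> snd p < d" using e(3)[OF that(1)] that(2) t by (auto simp: P_def)
    ultimately show ?thesis using d(2)[OF that(1)] by (intro prod_eqI) auto
  qed
  have Pbd: "P s t (b, d)" using s t e(2) by (simp add: P_def)
  have "(b, d) \<in># E \<and> (b, d) \<in># E'"
    using bd eqE[OF st] only Pbd unfolding U_def by blast
  then show False using disj by blast
qed

lemma pers_iso_sym: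
  assumes "pers_iso V W" and grp: "\<And>t. group (fst V t)"
    and closed: "\<And>s t v. s \<le> t \<Longrightarrow> v \<in> carrier (fst V s) \<Longrightarrow> snd V s t v \<in> carrier (fst V t)"
  shows "pers_iso W V"
proof -
  obtain \<theta> where th: "\<And>t. \<theta> t \<in> iso (fst V t) (fst W t)"
    and nat: "\<And>s t v. s \<le> t \<Longrightarrow> v \<in> carrier (fst V s) \<Longrightarrow> \<theta> t (snd V s t v) = snd W s t (\<theta> s v)"
    using assms(1) unfolding pers_iso_def by blast
  define \<eta> where "\<eta> t = inv_into (carrier (fst V t)) (\<theta> t)" for t
  have bij: "bij_betw (\<theta> t) (carrier (fst V t)) (carrier (fst W t))" for t
    using th by (simp add: iso_def)
  have eta: "\<eta> s w \<in> carrier (fst V s)" "\<theta> s (\<eta> s w) = w" if "w \<in> carrier (fst W s)" for s w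
    using bij[of s] that unfolding \<eta>_def bij_betw_def
    by (metis inv_into_into, metis f_inv_into_f)
  show ?thesis
    unfolding pers_iso_def
  proof (intro exI[of _ \<eta>] conjI allI impI ballI)
    show "\<eta> t \<in> iso (fst W t) (fst V t)" for t
      unfolding \<eta>_def by (rule group.iso_set_sym[OF grp th])
    fix s t :: real and w assume st: "s \<le> t" and w: "w \<in> carrier (fst W s)"
    have "snd W s t w = \<theta> t (snd V s t (\<eta> s w))"
      using nat[OF st eta(1)[OF w]] eta(2)[OF w] by simp
    then show "\<eta> t (snd W s t w) = snd V s t (\<eta> s w)"
      unfolding \<eta>_def[of t] using bij_betw_imp_inj_on[OF bij] closed[OF st eta(1)[OF w]]
      by (simp add: inv_into_f_f)
  qed
qed

section \<open>The elder rule computes the diagram\<close>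

text \<open>Occurrences in a multiset image can be relabelled by the elements of the original set. The
interval attached to an occurrence is then the one of the vertex that labels it.\<close>

lemma image_mset_index_bij:
  assumes "finite A"
  obtains \<beta> where "bij_betw \<beta> (bar_index (image_mset f (mset_set A))) A"
    "\<And>q. q \<in> bar_index (image_mset f (mset_set A)) \<Longrightarrow> f (\<beta> q) = fst q"
proof -
  let ?D = "image_mset f (mset_set A)"
  have count: "count ?D p = card {a\<in>A. f a = p}" for p
    using assms by (simp add: count_image_mset' Int_def conj_commute eq_commute)
  have "\<forall>p. \<exists>h. bij_betw h {0..<count ?D p} {a\<in>A. f a = p}"
    unfolding count using assms by (intro allI ex_bij_betw_nat_finite) simp
  then obtain h where h: "\<And>p. bij_betw (h p) {0..<count ?D p} {a\<in>A. f a = p}" by metis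
  define \<beta> where "\<beta> q = h (fst q) (snd q)" for q
  have mem: "\<beta> q \<in> A \<and> f (\<beta> q) = fst q" if "q \<in> bar_index ?D" for q
  proof -
    have "snd q \<in> {0..<count ?D (fst q)}" using that by (auto simp: bar_index_def)
    then show ?thesis using bij_betwE[OF h[of "fst q"]] unfolding \<beta>_def by blast
  qed
  have "bij_betw \<beta> (bar_index ?D) A"
    unfolding bij_betw_def
  proof
    show "inj_on \<beta> (bar_index ?D)"
    proof (rule inj_onI)
      fix q r assume q: "q \<in> bar_index ?D" and r: "r \<in> bar_index ?D" and eq: "\<beta> q = \<beta> r"
      then have "fst q = fst r" using mem[of q] mem[of r] by simp
      moreover have "snd q = snd r"
      proof (rule inj_onD[OF bij_betw_imp_inj_on[OF h[of "fst q"]]])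
        show "h (fst q) (snd q) = h (fst q) (snd r)" using eq \<open>fst q = fst r\<close> by (simp add: \<beta>_def)
        show "snd q \<in> {0..<count ?D (fst q)}" using q by (auto simp: bar_index_def)
        show "snd r \<in> {0..<count ?D (fst q)}" using r \<open>fst q = fst r\<close> by (auto simp: bar_index_def)
      qed
      ultimately show "q = r" by (rule prod_eqI)
    qed
    show "\<beta> ` bar_index ?D = A"
    proof
      show "\<beta> ` bar_index ?D \<subseteq> A" using mem by blast
      show "A \<subseteq> \<beta> ` bar_index ?D"
      proof
        fix a assume "a \<in> A"
        then have "a \<in> h (f a) ` {0..<count ?D (f a)}"
          using bij_betw_imp_surj_on[OF h[of "f a"]] by blast
        then obtain k where "k \<in> {0..<count ?D (f a)}" "a = h (f a) k" by blast
        then show "a \<in> \<beta> ` bar_index ?D"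
          by (intro image_eqI[of _ _ "(f a, k)"]) (auto simp: \<beta>_def bar_index_def)
      qed
    qed
  qed
  then show ?thesis using mem that by blast
qed

text \<open>A coefficient vector on the bars is sent to the homology class of the corresponding combination of bar
cycles. Bijectivity at each level is independence and spanning; compatibility with the structure
maps holds because a bar cycle becomes a boundary at the death of its bar.\<close>

lemma barcode_iso: "pers_iso (barcode_module (barcode x n)) (sublevel_module x n)"
proof -
  let ?D = "barcode x n" and ?K = "sublevel_complex x n"
  let ?J = "bar_index ?D"
  obtain \<beta> where \<beta>: "bij_betw \<beta> ?J (bars x n)"
    and f\<beta>: "\<And>q. q \<in> ?J \<Longrightarrow> (ereal (x (\<beta> q)), death x n (\<beta> q)) = fst q"
    using image_mset_index_bij[OF finite_bars, where f = "\<lambda>i. (ereal (x i), death x n i)"]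
    unfolding barcode_def by metis
  define \<gamma> where "\<gamma> = inv_into ?J \<beta>"
  have \<gamma>: "\<gamma> i \<in> ?J" "\<beta> (\<gamma> i) = i" "fst (\<gamma> i) = (ereal (x i), death x n i)" if "i \<in> bars x n" for i
  proof -
    show 1: "\<gamma> i \<in> ?J" using \<beta> that unfolding \<gamma>_def bij_betw_def by (metis inv_into_into)
    show 2: "\<beta> (\<gamma> i) = i" using \<beta> that unfolding \<gamma>_def bij_betw_def by (metis f_inv_into_f)
    show "fst (\<gamma> i) = (ereal (x i), death x n i)" using f\<beta>[OF 1] 2 by simp
  qed
  have \<gamma>\<beta>: "\<gamma> (\<beta> q) = q" "\<beta> q \<in> bars x n" if "q \<in> ?J" for q
    using \<beta> that unfolding \<gamma>_def bij_betw_def by (simp, blast)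
  define C where "C v = bar_chain x n (\<lambda>i. v (\<gamma> i))" for v
  define \<phi> where "\<phi> t v = homology_class 0 (?K t) (C v)" for t v
  have Ccong: "C v = C w" if "\<And>q. q \<in> ?J \<Longrightarrow> v q = w q" for v w
    unfolding C_def bar_chain_def using that \<gamma>(1) by (intro ext sum.cong) auto
  have Cadd: "(\<lambda>\<sigma>. C v \<sigma> + C w \<sigma>) = C (\<lambda>q. v q + w q)" for v w
    unfolding C_def by (rule bar_chain_add[symmetric])
  have bar_alive: "bar_alive x n t i" if "v \<in> carrier (fst (barcode_module ?D) t)" "i \<in> bars x n" "v (\<gamma> i) \<noteq> 0" for v t i
    using that \<gamma>[OF that(2)] unfolding barcode_module_carrier bar_alive_def by auto
  have Cmem: "C v \<in> carrier (chain_group 0 (?K t))" if "v \<in> carrier (fst (barcode_module ?D) t)" for v t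
    unfolding C_def using bar_alive[OF that] by (intro bar_chain_in_chain_group) (simp add: bar_alive_def)
  show ?thesis
    unfolding pers_iso_def
  proof (intro exI[of _ \<phi>] conjI allI impI ballI)
    fix t
    let ?W = "fst (barcode_module ?D) t"
    have V: "fst (sublevel_module x n) t = homology 0 (?K t)" by (simp add: sublevel_module_def)
    have "\<phi> t \<in> hom ?W (homology 0 (?K t))"
    proof (rule homI)
      fix v w assume v: "v \<in> carrier ?W" and w: "w \<in> carrier ?W"
      show "\<phi> t v \<in> carrier (homology 0 (?K t))"
        unfolding \<phi>_def carrier_homology_0 using Cmem[OF v] by (rule imageI)
      have "C (v \<otimes>\<^bsub>?W\<^esub> w) = C (\<lambda>q. v q + w q)"
        unfolding mult_barcode_module by (rule Ccong) simp
      then show "\<phi> t (v \<otimes>\<^bsub>?W\<^esub> w) = \<phi> t v \<otimes>\<^bsub>homology 0 (?K t)\<^esub> \<phi> t w"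
        unfolding \<phi>_def mult_homology_0[OF down_closed_sublevel Cmem[OF v] Cmem[OF w]] Cadd by simp
    qed
    moreover have "inj_on (\<phi> t) (carrier ?W)"
    proof (rule inj_onI)
      fix v w assume v: "v \<in> carrier ?W" and w: "w \<in> carrier ?W" and eq: "\<phi> t v = \<phi> t w"
      have bd: "bar_chain x n (\<lambda>i. v (\<gamma> i) + w (\<gamma> i)) \<in> boundaries 0 (?K t)"
        using eq unfolding \<phi>_def homology_class_eq_iff C_def bar_chain_add .
      have "v (\<gamma> i) + w (\<gamma> i) = 0" if "i \<in> bars x n" for i
      proof (rule bar_chain_independent[OF _ bd that])
        fix j assume "j \<in> bars x n" "v (\<gamma> j) + w (\<gamma> j) \<noteq> 0"
        then show "bar_alive x n t j" using bar_alive[OF v, of j] bar_alive[OF w, of j] by (metis add_0)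
      qed
      then have "v q = w q" if "q \<in> ?J" for q
        using \<gamma>\<beta>[OF that] by (metis bit_add_eq_0_iff)
      then show "v = w" using v w unfolding barcode_module_carrier by (blast intro: extensionalityI)
    qed
    moreover have "carrier (homology 0 (?K t)) \<subseteq> \<phi> t ` carrier ?W"
    proof
      fix c' assume "c' \<in> carrier (homology 0 (?K t))"
      then obtain c where c: "c \<in> carrier (chain_group 0 (?K t))" "c' = homology_class 0 (?K t) c"
        unfolding carrier_homology_0 by (rule imageE)
      obtain u where u: "\<forall>i. u i \<noteq> 0 \<longrightarrow> bar_alive x n t i"
        "(\<lambda>\<sigma>. c \<sigma> + bar_chain x n u \<sigma>) \<in> boundaries 0 (?K t)"
        using bar_chain_spans[OF c(1)] by auto
      define v where "v = (\<lambda>q\<in>?J. u (\<beta> q))"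
      have "v \<in> carrier ?W"
        unfolding barcode_module_carrier
      proof (intro conjI ballI impI)
        show "v \<in> extensional ?J" by (simp add: v_def)
        fix q assume q: "q \<in> ?J" "v q \<noteq> 0"
        then have "bar_alive x n t (\<beta> q)" using u(1) by (simp add: v_def)
        then show "fst (fst q) \<le> ereal t" "ereal t < snd (fst q)"
          using f\<beta>[OF q(1), symmetric] by (simp_all add: bar_alive_def)
      qed
      moreover have "C v = bar_chain x n u"
        unfolding C_def bar_chain_def v_def using \<gamma> by (intro ext sum.cong) auto
      then have "c' = \<phi> t v" unfolding c(2) \<phi>_def homology_class_eq_iff using u(2) by simp
      ultimately show "c' \<in> \<phi> t ` carrier ?W" by (intro image_eqI)
    qed
    ultimately show "\<phi> t \<in> iso ?W (fst (sublevel_module x n) t)"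
      unfolding V iso_def bij_betw_def by (auto simp: hom_def Pi_iff)
  next
    fix s t :: real and v
    assume st: "s \<le> t" and v: "v \<in> carrier (fst (barcode_module ?D) s)"
    let ?v' = "snd (barcode_module ?D) s t v"
    have "(\<lambda>\<sigma>. C ?v' \<sigma> + C v \<sigma>) \<in> boundaries 0 (?K t)"
      unfolding Cadd unfolding C_def
    proof (rule bar_chain_boundary)
      fix i assume i: "i \<in> bars x n" and nz: "?v' (\<gamma> i) + v (\<gamma> i) \<noteq> 0"
      show "death x n i \<le> ereal t"
      proof (rule ccontr)
        assume "\<not> death x n i \<le> ereal t"
        then have "?v' (\<gamma> i) = v (\<gamma> i) \<or> \<not> x i \<le> s"
          using \<gamma>[OF i] by (auto simp: barcode_module_map not_le)
        then have nle: "\<not> x i \<le> s" "v (\<gamma> i) \<noteq> 0"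
          using nz \<gamma>[OF i] by (auto simp: barcode_module_map split: if_splits)
        then show False using bar_alive[OF v i] by (simp add: bar_alive_def)
      qed
    qed
    then have "\<phi> t ?v' = homology_class 0 (?K t) (C v)" unfolding \<phi>_def homology_class_eq_iff .
    also have "\<dots> = snd (sublevel_module x n) s t (\<phi> s v)"
      unfolding sublevel_module_def \<phi>_def using homology_incl_class[OF sublevel_mono[OF st]] by simp
    finally show "\<phi> t ?v' = snd (sublevel_module x n) s t (\<phi> s v)" .
  qed
qed

lemma sublevel_module_map_closed:
  assumes st: "s \<le> t" and v: "v \<in> carrier (fst (sublevel_module x n) s)"
  shows "snd (sublevel_module x n) s t v \<in> carrier (fst (sublevel_module x n) t)"
proof -
  have sub: "sublevel_complex x n s \<subseteq> sublevel_complex x n t" by (rule sublevel_mono[OF st])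
  obtain c where c: "c \<in> carrier (chain_group 0 (sublevel_complex x n s))"
    "v = homology_class 0 (sublevel_complex x n s) c"
    using v unfolding sublevel_module_def fst_conv carrier_homology_0 by (rule imageE)
  have "c \<in> carrier (chain_group 0 (sublevel_complex x n t))"
    using c(1) sub unfolding carrier_chain_group by blast
  then show ?thesis
    unfolding sublevel_module_def fst_conv snd_conv c(2) homology_incl_class[OF sub] carrier_homology_0
    by (rule imageI)
qed

text \<open>Barcodes of one module have the same ranks and are therefore equal, so the barcode of the elder rule is
the only candidate for the diagram.\<close>

lemma PD0_eq_barcode: "PD0 x n = barcode x n"
proof -
  have iso: "pers_iso (sublevel_module x n) (barcode_module (barcode x n))"
    by (rule pers_iso_sym[OF barcode_iso group_barcode_module barcode_module_map_closed])
  show ?thesis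
    unfolding PD0_def
  proof (rule the_equality)
    show "set_mset (barcode x n) \<subseteq> Delta \<and> pers_iso (sublevel_module x n) (barcode_module (barcode x n))"
      using barcode_in_Delta iso by blast
    fix D assume D: "set_mset D \<subseteq> Delta \<and> pers_iso (sublevel_module x n) (barcode_module D)"
    show "D = barcode x n"
    proof (rule pers_rank_determines)
      fix s t :: real assume st: "s \<le> t"
      have "(2::nat) ^ pers_rank D s t = 2 ^ pers_rank (barcode x n) s t"
        using card_image_pers_iso[OF _ st sublevel_module_map_closed[OF st], of x n]
          D iso by metis
      then show "pers_rank D s t = pers_rank (barcode x n) s t" by simp
    qed (use D barcode_in_Delta in auto)
  qed
qed

section \<open>The diagram as a counting measure\<close>

definition mortal_bars :: "(nat \<Rightarrow> real) \<Rightarrow> nat \<Rightarrow> nat set" where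
  "mortal_bars x n = {i\<in>bars x n. death x n i \<noteq> \<infinity>}"

lemma finite_mortal_bars [simp]: "finite (mortal_bars x n)"
  by (simp add: mortal_bars_def)

definition bar :: "(nat \<Rightarrow> real) \<Rightarrow> nat \<Rightarrow> nat \<Rightarrow> ereal \<times> ereal" where
  "bar x n i = (ereal (x i), death x n i)"

lemma tilde_Delta_iff: "p \<in> tilde_Delta \<longleftrightarrow> (\<exists>b d. p = (ereal b, ereal d) \<and> b < d)"
  by (auto simp: tilde_Delta_def Delta_def)

lemma bar_in_tilde_Delta: "i \<in> bars x n \<Longrightarrow> bar x n i \<in> tilde_Delta \<longleftrightarrow> i \<in> mortal_bars x n"
  by (cases "death x n i") (auto simp: bar_def tilde_Delta_iff bars_def mortal_bars_def)

lemma open_Delta: "open Delta"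
proof -
  have "open {z :: ereal \<times> ereal. - \<infinity> < fst z}" "open {z :: ereal \<times> ereal. fst z < snd z}"
    by (intro open_Collect_less continuous_intros)+
  then have "open ({z :: ereal \<times> ereal. - \<infinity> < fst z} \<inter> {z. fst z < snd z})" by (rule open_Int)
  also have "{z :: ereal \<times> ereal. - \<infinity> < fst z} \<inter> {z. fst z < snd z} = Delta"
    by (auto simp: Delta_def)
  finally show ?thesis .
qed

lemma open_tilde_Delta: "open tilde_Delta"
proof -
  have "open {z :: ereal \<times> ereal. snd z < \<infinity>}"
    by (intro open_Collect_less continuous_intros)+
  then have "open (Delta \<inter> {z :: ereal \<times> ereal. snd z < \<infinity>})" using open_Delta by (intro open_Int)
  also have "Delta \<inter> {z :: ereal \<times> ereal. snd z < \<infinity>} = tilde_Delta"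
  proof (rule Set.set_eqI)
    fix z :: "ereal \<times> ereal"
    show "z \<in> Delta \<inter> {z. snd z < \<infinity>} \<longleftrightarrow> z \<in> tilde_Delta"
      unfolding tilde_Delta_iff by (cases z; cases "fst z"; cases "snd z") (auto simp: Delta_def)
  qed
  finally show ?thesis .
qed

lemma tilde_Delta_subset: "tilde_Delta \<subseteq> Delta"
  by (simp add: tilde_Delta_def)

lemma sets_tilde_xi0: "sets (tilde_xi0 x n) = sets (restrict_space borel tilde_Delta)"
proof -
  have "sets (tilde_xi0 x n) = sets (restrict_space (restrict_space borel Delta) tilde_Delta)"
    unfolding tilde_xi0_def xi0_def by (rule sets_restrict_space_cong) simp
  also have "\<dots> = sets (restrict_space borel tilde_Delta)"
    unfolding sets_restrict_restrict_space using tilde_Delta_subset by (simp add: Int_absorb1)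
  finally show ?thesis .
qed

text \<open>Pushing forward the counting measure on a set of vertices reduces all integrals against the diagram
to finite sums.\<close>

lemma tilde_xi0_eq_distr:
  "tilde_xi0 x n = distr (count_space (mortal_bars x n)) (restrict_space borel tilde_Delta) (bar x n)"
    (is "_ = distr ?C ?R _")
proof (rule measure_eqI)
  show "sets (tilde_xi0 x n) = sets (distr ?C ?R (bar x n))" by (simp add: sets_tilde_xi0)
  have meas: "bar x n \<in> measurable ?C ?R"
    using bar_in_tilde_Delta[of _ x n] by (auto simp: space_restrict_space mortal_bars_def)
  have tD: "tilde_Delta \<in> sets (restrict_space borel Delta)"
    using open_tilde_Delta tilde_Delta_subset by (auto simp: sets_restrict_space_iff open_Delta)
  fix A assume "A \<in> sets (tilde_xi0 x n)"
  then have A: "A \<in> sets ?R" by (simp add: sets_tilde_xi0)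
  then have sub: "A \<subseteq> tilde_Delta" using sets.sets_into_space[OF A] by (simp add: space_restrict_space)
  have AD: "A \<in> sets (restrict_space borel Delta)"
    using A sub tilde_Delta_subset by (auto simp: sets_restrict_space_iff open_Delta open_tilde_Delta)
  have "emeasure (tilde_xi0 x n) A = emeasure (counting_measure_of (PD0 x n)) A"
    unfolding tilde_xi0_def xi0_def using tD sub tilde_Delta_subset
    by (intro emeasure_restrict_space) (simp_all add: Int_absorb2)
  also have "\<dots> = (\<Sum>p\<in>#barcode x n. indicator A p)"
    unfolding PD0_eq_barcode by (rule emeasure_counting_measure_of[OF AD])
  also have "\<dots> = (\<Sum>i\<in>bars x n. indicator A (bar x n i))"
    by (simp add: barcode_def bar_def sum_unfold_sum_mset image_mset.compositionality comp_def)
  also have "\<dots> = (\<Sum>i\<in>{i\<in>bars x n. bar x n i \<in> A}. 1)"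
    by (subst sum.inter_filter[OF finite_bars]) (rule sum.cong, auto simp: indicator_def)
  also have "{i\<in>bars x n. bar x n i \<in> A} = bar x n -` A \<inter> space ?C"
    using sub bar_in_tilde_Delta[of _ x n] by (auto simp: mortal_bars_def)
  also have "(\<Sum>i\<in>bar x n -` A \<inter> space ?C. 1) = emeasure ?C (bar x n -` A \<inter> space ?C)"
    by (subst emeasure_count_space_finite) auto
  also have "\<dots> = emeasure (distr ?C ?R (bar x n)) A"
    by (rule emeasure_distr[symmetric, OF meas A])
  finally show "emeasure (tilde_xi0 x n) A = emeasure (distr ?C ?R (bar x n)) A" .
qed

lemma bar_measurable:
  "bar x n \<in> measurable (count_space (mortal_bars x n)) (restrict_space borel tilde_Delta)"
  using bar_in_tilde_Delta[of _ x n] by (auto simp: space_restrict_space mortal_bars_def)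

lemma integral_tilde_xi0:
  fixes h :: "ereal \<times> ereal \<Rightarrow> real"
  assumes "h \<in> borel_measurable (restrict_space borel tilde_Delta)"
  shows "(\<integral>z. h z \<partial>tilde_xi0 x n) = (\<Sum>i\<in>mortal_bars x n. h (bar x n i))"
  unfolding tilde_xi0_eq_distr
  by (simp add: integral_distr[OF bar_measurable assms] lebesgue_integral_count_space_finite)

lemma emeasure_tilde_xi0: "emeasure (tilde_xi0 x n) tilde_Delta = of_nat (card (mortal_bars x n))"
proof -
  have "tilde_Delta \<in> sets (restrict_space borel tilde_Delta)"
    using sets.top[of "restrict_space borel tilde_Delta"] by (simp add: space_restrict_space)
  moreover have "bar x n -` tilde_Delta \<inter> space (count_space (mortal_bars x n)) = mortal_bars x n"
    using bar_in_tilde_Delta[of _ x n] by (auto simp: mortal_bars_def)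
  ultimately show ?thesis
    unfolding tilde_xi0_eq_distr by (simp add: emeasure_distr[OF bar_measurable])
qed

lemma measure_tilde_xi0: "measure (tilde_xi0 x n) tilde_Delta = real (card (mortal_bars x n))"
  by (simp add: measure_def emeasure_tilde_xi0)

lemma scale_measure_eq_density: "scale_measure c M = density M (\<lambda>_. c)"
  by (rule measure_eqI) (simp_all add: emeasure_density_const)

lemma integral_normalized_tilde_xi0:
  fixes h :: "ereal \<times> ereal \<Rightarrow> real"
  assumes h: "h \<in> borel_measurable (restrict_space borel tilde_Delta)"
    and pos: "mortal_bars x n \<noteq> {}"
  shows "(\<integral>z. h z \<partial>normalized (tilde_xi0 x n)) =
    (\<Sum>i\<in>mortal_bars x n. h (bar x n i)) / card (mortal_bars x n)"
proof -
  let ?N = "tilde_xi0 x n" and ?c = "card (mortal_bars x n)"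
  have "?c > 0" using pos by (simp add: card_gt_0_iff)
  have sp: "space ?N = tilde_Delta"
    by (simp add: tilde_xi0_eq_distr space_restrict_space)
  have "inverse (emeasure ?N (space ?N)) = ennreal (1 / ?c)"
    unfolding sp emeasure_tilde_xi0 using \<open>?c > 0\<close>
    by (simp add: ennreal_of_nat_eq_real_of_nat inverse_ennreal divide_inverse)
  then have "normalized ?N = density ?N (\<lambda>_. ennreal (1 / ?c))"
    by (simp add: normalized_def scale_measure_eq_density)
  moreover have "h \<in> borel_measurable ?N"
    using h by (simp cong: measurable_cong_sets add: sets_tilde_xi0)
  ultimately have "(\<integral>z. h z \<partial>normalized ?N) = (\<integral>z. (1 / ?c) * h z \<partial>?N)"
    by (simp add: integral_real_density)
  then show ?thesis by (simp add: integral_tilde_xi0[OF h] mult.commute)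
qed

section \<open>Comparing a barcode with its sequence\<close>

text \<open>The peak at which the bar of \<open>i\<close> dies: of all places between \<open>i\<close> and its elder where the maximum is
attained, the one closest to \<open>i\<close>. Up to there the sequence stays strictly below the peak, which
makes the choice of peak almost injective.\<close>

lemma first_peak:
  assumes i: "i \<in> mortal_bars x n"
  shows "\<exists>m\<in>{1..n}. ereal (x m) = death x n i \<and>
    (\<forall>k\<in>{min i m..max i m}. k \<noteq> m \<longrightarrow> x k < x m)"
proof -
  let ?e = "elder x n i"
  have fin: "death x n i \<noteq> \<infinity>" and b: "i \<in> bars x n" using i by (auto simp: mortal_bars_def)
  note e = elder[OF fin]
  let ?I = "{min i ?e..max i ?e}"
  let ?d = "\<lambda>m::nat. (m - i) + (i - m)"
  obtain m0 where m0: "m0 \<in> ?I" "path_max x i ?e = x m0" using path_max_attained[of i ?e x] by blast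
  \<comment> \<open>With truncated subtraction, \<open>?d m\<close> is the distance between \<open>m\<close> and \<open>i\<close>.\<close>
  have "\<exists>m. (m \<in> ?I \<and> x m = path_max x i ?e) \<and> (\<forall>l. l \<in> ?I \<and> x l = path_max x i ?e \<longrightarrow> ?d m \<le> ?d l)"
    by (rule ex_has_least_nat[of _ m0]) (use m0 in auto)
  then obtain m where m: "m \<in> ?I" "x m = path_max x i ?e"
    and least: "\<And>l. l \<in> ?I \<Longrightarrow> x l = path_max x i ?e \<Longrightarrow> ?d m \<le> ?d l" by blast
  have "m \<in> {1..n}" using m(1) e(1) b by (auto simp: bars_def)
  moreover have "ereal (x m) = death x n i" using m(2) e(3) by simp
  moreover have "x k < x m" if k: "k \<in> {min i m..max i m}" "k \<noteq> m" for k
  proof -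
    have kI: "k \<in> ?I" using k(1) m(1) by auto
    have "\<not> ?d m \<le> ?d k" using k by auto
    then have "x k \<noteq> path_max x i ?e" using least[OF kI] by blast
    moreover have "x k \<le> path_max x i ?e" using kI path_max_le_iff[of x i ?e "path_max x i ?e"] by blast
    ultimately show ?thesis using m(2) by simp
  qed
  ultimately show ?thesis by blast
qed

text \<open>A peak is shared by at most two bars, one from each side: if \<open>i\<close> and \<open>j\<close> lie on the same side of their
common peak, they are connected strictly below it, and the younger of the two would have died
earlier.\<close>

lemma sum_deaths_le:
  assumes nonneg: "\<And>a. 0 \<le> \<phi> a"
  shows "(\<Sum>i\<in>mortal_bars x n. \<phi> (real_of_ereal (death x n i))) \<le> 2 * (\<Sum>i=1..n. \<phi> (x i) :: real)"
proof -
  let ?B = "mortal_bars x n"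
  obtain m where m: "\<And>i. i \<in> ?B \<Longrightarrow> m i \<in> {1..n} \<and> ereal (x (m i)) = death x n i \<and>
      (\<forall>k\<in>{min i (m i)..max i (m i)}. k \<noteq> m i \<longrightarrow> x k < x (m i))"
    using first_peak[of _ x n] by metis
  \<comment> \<open>The peak of a bar together with the side from which the bar reaches it.\<close>
  define \<mu> where "\<mu> i = (m i, i < m i)" for i
  have mi: "i \<noteq> m i" if "i \<in> ?B" for i
    using m[OF that] that by (auto simp: mortal_bars_def bars_def)
  have inj: "inj_on \<mu> ?B"
  proof (rule inj_onI, rule ccontr)
    fix i j assume i: "i \<in> ?B" and j: "j \<in> ?B" and eq: "\<mu> i = \<mu> j" and ne: "i \<noteq> j"
    have mm: "m j = m i" "i < m i \<longleftrightarrow> j < m i" using eq by (auto simp: \<mu>_def)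
    have *: "x k < x (m i)" if k: "k \<in> {min i j..max i j}" for k
    proof -
      have "k \<noteq> m i \<and> (k \<in> {min i (m i)..max i (m i)} \<or> k \<in> {min j (m j)..max j (m j)})"
        using k mm mi[OF i] mi[OF j] by auto
      then show ?thesis using m[OF i] m[OF j] mm(1) by metis
    qed
    have small: "path_max x i j < x (m i)" using path_max_attained[of i j x] * by auto
    have ij: "i \<in> {1..n}" "j \<in> {1..n}" using i j by (auto simp: mortal_bars_def bars_def)
    consider "older x j i" | "older x i j" using older_linear[OF ne] by blast
    then show False
    proof cases
      case 1
      then have "ereal (x (m i)) \<le> ereal (path_max x i j)" using death_le[OF ij(2)] m[OF i] by metis
      then show False using small by simp
    next
      case 2
      then have "ereal (x (m i)) \<le> ereal (path_max x j i)" using death_le[OF ij(1)] m[OF j] mm(1) by metis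
      then show False using small by (simp add: path_max_commute)
    qed
  qed
  have "(\<Sum>i\<in>?B. \<phi> (real_of_ereal (death x n i))) = (\<Sum>i\<in>?B. \<phi> (x (fst (\<mu> i))))"
  proof (rule sum.cong[OF refl])
    fix i assume "i \<in> ?B"
    then have "death x n i = ereal (x (m i))" using m by simp
    then show "\<phi> (real_of_ereal (death x n i)) = \<phi> (x (fst (\<mu> i)))" by (simp add: \<mu>_def)
  qed
  also have "\<dots> = (\<Sum>p\<in>\<mu> ` ?B. \<phi> (x (fst p)))" by (simp add: sum.reindex[OF inj])
  also have "\<dots> \<le> (\<Sum>p\<in>{1..n} \<times> (UNIV :: bool set). \<phi> (x (fst p)))"
    using m by (intro sum_mono2) (auto simp: \<mu>_def nonneg)
  also have "\<dots> = (\<Sum>i\<in>{1..n}. \<Sum>s\<in>(UNIV :: bool set). \<phi> (x i))"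
    by (simp only: sum.cartesian_product case_prod_unfold)
  also have "\<dots> = 2 * (\<Sum>i=1..n. \<phi> (x i))" by (simp add: sum_distrib_left UNIV_bool)
  finally show ?thesis .
qed

lemma sum_births_le:
  assumes nonneg: "\<And>a. 0 \<le> \<phi> a"
  shows "(\<Sum>i\<in>mortal_bars x n. \<phi> (x i)) \<le> (\<Sum>i=1..n. \<phi> (x i) :: real)"
  by (intro sum_mono2) (auto simp: nonneg mortal_bars_def bars_def)

text \<open>The component of a strict local minimum is a single vertex when it appears, so it cannot die at
once. Only the oldest vertex lives forever, which accounts for the added 1.\<close>

lemma card_local_minima_le:
  "card {k. k + 3 \<le> n \<and> x (k + 2) < x (k + 1) \<and> x (k + 2) < x (k + 3)} \<le> card (mortal_bars x n) + 1"
    (is "card ?M \<le> _")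
proof -
  let ?E = "{i\<in>{1..n}. death x n i = \<infinity>}"
  have "(\<lambda>k. k + 2) ` ?M \<subseteq> mortal_bars x n \<union> ?E"
  proof
    fix i assume "i \<in> (\<lambda>k. k + 2) ` ?M"
    then obtain k where i: "i = k + 2" and k: "k + 3 \<le> n" "x i < x (k + 1)" "x i < x (k + 3)" by auto
    have rng: "i \<in> {1..n}" using i k(1) by simp
    show "i \<in> mortal_bars x n \<union> ?E"
    proof (cases "death x n i = \<infinity>")
      case True
      then show ?thesis using rng by simp
    next
      case False
      note e = elder[OF False]
      have "elder x n i \<noteq> i" using e(2) by auto
      then have "k + 1 \<in> {min i (elder x n i)..max i (elder x n i)} \<or>
          k + 3 \<in> {min i (elder x n i)..max i (elder x n i)}" using i by auto
      then have "x i < path_max x i (elder x n i)"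
        using k(2,3) path_max_le_iff[of x i "elder x n i" "path_max x i (elder x n i)"] by force
      then show ?thesis using e(3) rng False by (simp add: mortal_bars_def bars_def)
    qed
  qed
  then have "card ((\<lambda>k. k + 2) ` ?M) \<le> card (mortal_bars x n \<union> ?E)" by (intro card_mono) auto
  also have "\<dots> \<le> card (mortal_bars x n) + card ?E" by (rule card_Un_le)
  also have "card ?E \<le> 1"
  proof (rule card_le_Suc0_iff_eq[THEN iffD2, unfolded One_nat_def[symmetric]])
    show "\<forall>i\<in>?E. \<forall>j\<in>?E. i = j"
    proof (intro ballI, rule ccontr)
      fix i j assume i: "i \<in> ?E" and j: "j \<in> ?E" and "i \<noteq> j"
      then consider "older x i j" | "older x j i" using older_linear by blast
      then show False using death_le[of j n x i] death_le[of i n x j] i j by cases auto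
    qed
  qed simp
  finally have "card ((\<lambda>k. k + 2) ` ?M) \<le> card (mortal_bars x n) + 1" by simp
  moreover have "card ((\<lambda>k. k + 2) ` ?M) = card ?M" by (intro card_image) (simp add: inj_on_def)
  ultimately show ?thesis by simp
qed

section \<open>Maximal ergodic inequality\<close>

definition birkhoff_sum :: "('a \<Rightarrow> 'a) \<Rightarrow> ('a \<Rightarrow> real) \<Rightarrow> nat \<Rightarrow> 'a \<Rightarrow> real" where
  "birkhoff_sum T u n x = (\<Sum>k<n. u ((T ^^ k) x))"

lemma birkhoff_sum_0 [simp]: "birkhoff_sum T u 0 x = 0"
  by (simp add: birkhoff_sum_def)

lemma birkhoff_sum_Suc: "birkhoff_sum T u (Suc n) x = u x + birkhoff_sum T u n (T x)"
  unfolding birkhoff_sum_def by (subst sum.lessThan_Suc_shift) (simp add: funpow_swap1)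

locale measure_preserving = prob_space +
  fixes T :: "'a \<Rightarrow> 'a"
  assumes T_measurable [measurable]: "T \<in> measurable M M"
    and distr_T: "distr M M T = M"
begin

lemma T_funpow_measurable [measurable]: "(T ^^ k) \<in> measurable M M"
  by (induction k) (simp_all add: measurable_comp[OF _ T_measurable])

lemma birkhoff_sum_measurable [measurable]:
  assumes [measurable]: "u \<in> borel_measurable M"
  shows "birkhoff_sum T u n \<in> borel_measurable M"
  unfolding birkhoff_sum_def by measurable

lemma integrable_T:
  fixes u :: "'a \<Rightarrow> real"
  assumes "integrable M u"
  shows "integrable M (\<lambda>x. u (T x))" "(\<integral>x. u (T x) \<partial>M) = (\<integral>x. u x \<partial>M)"
proof -
  have u: "integrable (distr M M T) u" using assms by (simp add: distr_T)
  show "integrable M (\<lambda>x. u (T x))" by (rule integrable_distr[OF T_measurable u])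
  show "(\<integral>x. u (T x) \<partial>M) = (\<integral>x. u x \<partial>M)"
    using integral_distr[OF T_measurable, of u] assms by (simp add: distr_T borel_measurable_integrable)
qed

lemma integrable_T_funpow:
  fixes u :: "'a \<Rightarrow> real"
  assumes "integrable M u"
  shows "integrable M (\<lambda>x. u ((T ^^ k) x))"
proof (induction k)
  case (Suc k)
  from integrable_T(1)[OF Suc] show ?case by (simp add: funpow_swap1)
qed (simp add: assms)

lemma integrable_birkhoff_sum: "integrable M u \<Longrightarrow> integrable M (birkhoff_sum T u n)"
  unfolding birkhoff_sum_def by (intro Bochner_Integration.integrable_sum integrable_T_funpow)

definition max_sum :: "('a \<Rightarrow> real) \<Rightarrow> nat \<Rightarrow> 'a \<Rightarrow> real" where
  "max_sum u N x = Max ((\<lambda>n. birkhoff_sum T u n x) ` {..N})"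

lemma max_sum_ge: "n \<le> N \<Longrightarrow> birkhoff_sum T u n x \<le> max_sum u N x"
  unfolding max_sum_def by (intro Max_ge) auto

lemma max_sum_nonneg: "0 \<le> max_sum u N x"
  using max_sum_ge[of 0 N u x] by simp

lemma max_sum_Suc: "max_sum u (Suc N) x = max (birkhoff_sum T u (Suc N) x) (max_sum u N x)"
  unfolding max_sum_def atMost_Suc by (simp add: Max_insert)

lemma integrable_max_sum:
  assumes "integrable M u"
  shows "integrable M (max_sum u N)"
proof (induction N)
  case 0
  then show ?case by (simp add: max_sum_def cong: integrable_cong)
next
  case (Suc N)
  then show ?case unfolding max_sum_Suc[abs_def]
    by (intro Bochner_Integration.integrable_max integrable_birkhoff_sum assms)
qed

text \<open>A positive maximum is attained by a nonempty sum, and dropping its first term leaves a sum started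
one step later.\<close>

lemma max_sum_pos_le:
  assumes "0 < max_sum u N x"
  shows "max_sum u N x \<le> u x + max_sum u N (T x)"
proof -
  have "max_sum u N x \<in> (\<lambda>n. birkhoff_sum T u n x) ` {..N}"
    unfolding max_sum_def by (intro Max_in) auto
  then obtain n where n: "n \<le> N" "max_sum u N x = birkhoff_sum T u n x" by auto
  then obtain k where "n = Suc k" using assms by (cases n) auto
  then show ?thesis using n max_sum_ge[of k N u "T x"] by (simp add: birkhoff_sum_Suc)
qed

text \<open>Garsia's argument: where the maximum \<open>max_sum u N\<close> is positive, \<open>u\<close> is at least its
decrement along \<open>T\<close>, and elsewhere the decrement is nonpositive; the decrement has integral zero.
Letting \<open>N\<close> grow, the sets exhaust the event in question.\<close>

lemma maximal_ergodic:
  assumes u: "integrable M u"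
  shows "0 \<le> (\<integral>x. u x * indicator {x. \<exists>n. 0 < birkhoff_sum T u n x} x \<partial>M)"
proof -
  have [measurable]: "u \<in> borel_measurable M" using u by simp
  have [measurable]: "max_sum u N \<in> borel_measurable M" for N using integrable_max_sum[OF u] by simp
  let ?A = "\<lambda>N. {x\<in>space M. 0 < max_sum u N x}"
  have nonneg: "0 \<le> (\<integral>x. u x * indicator (?A N) x \<partial>M)" for N
  proof -
    have "0 = (\<integral>x. max_sum u N x - max_sum u N (T x) \<partial>M)"
      using integrable_T[OF integrable_max_sum[OF u, of N]] integrable_max_sum[OF u, of N] by simp
    also have "\<dots> \<le> (\<integral>x. u x * indicator (?A N) x \<partial>M)"
    proof (rule integral_mono)
      show "integrable M (\<lambda>x. max_sum u N x - max_sum u N (T x))"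
        using integrable_T[OF integrable_max_sum[OF u, of N]] integrable_max_sum[OF u, of N] by simp
      show "integrable M (\<lambda>x. u x * indicator (?A N) x)"
        using u by (intro integrable_real_mult_indicator) measurable
      fix x assume x: "x \<in> space M"
      show "max_sum u N x - max_sum u N (T x) \<le> u x * indicator (?A N) x"
        using max_sum_pos_le[of u N x] max_sum_nonneg[of u N x] max_sum_nonneg[of u N "T x"] x
        by (cases "0 < max_sum u N x") auto
    qed
    finally show ?thesis .
  qed
  have "(\<lambda>N. \<integral>x. u x * indicator (?A N) x \<partial>M)
      \<longlonglongrightarrow> (\<integral>x. u x * indicator {x. \<exists>n. 0 < birkhoff_sum T u n x} x \<partial>M)"
  proof (rule integral_dominated_convergence[where w = "\<lambda>x. \<bar>u x\<bar>"])
    show "AE x in M. (\<lambda>N. u x * indicator (?A N) x)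
        \<longlonglongrightarrow> u x * indicator {x. \<exists>n. 0 < birkhoff_sum T u n x} x"
    proof (rule AE_I2, rule tendsto_eventually)
      fix x assume x: "x \<in> space M"
      show "\<forall>\<^sub>F N in sequentially. u x * indicator (?A N) x
          = u x * indicator {x. \<exists>n. 0 < birkhoff_sum T u n x} x"
      proof (cases "\<exists>n. 0 < birkhoff_sum T u n x")
        case True
        then obtain n where n: "0 < birkhoff_sum T u n x" by blast
        show ?thesis using eventually_ge_at_top[of n]
        proof eventually_elim
          case (elim N)
          then have "0 < max_sum u N x" using max_sum_ge[of n N u x] n by linarith
          then show ?case using True x by simp
        qed
      next
        case False
        have "max_sum u N x \<in> (\<lambda>n. birkhoff_sum T u n x) ` {..N}" for N
          unfolding max_sum_def by (intro Max_in) auto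
        then have "\<not> 0 < max_sum u N x" for N using False by (metis imageE)
        then show ?thesis using False by simp
      qed
    qed
  qed (use u in \<open>auto simp: indicator_def\<close>)
  then show ?thesis by (rule tendsto_lowerbound) (simp_all add: nonneg)
qed

text \<open>Applied to \<open>u k - \<delta>\<close>, the maximal ergodic inequality bounds the probability that some average
of \<open>u k\<close> exceeds \<open>\<delta>\<close> by \<open>(\<integral>x. u k x \<partial>M) / \<delta>\<close>. This tends to zero, so almost no point has such an
average for every \<open>k\<close>.\<close>

lemma maximal_inequality_null:
  fixes u :: "nat \<Rightarrow> 'a \<Rightarrow> real"
  assumes u: "\<And>k. integrable M (u k)" and nonneg: "\<And>k x. 0 \<le> u k x"
    and lim: "(\<lambda>k. \<integral>x. u k x \<partial>M) \<longlonglongrightarrow> 0"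
  shows "AE x in M. \<forall>\<delta>>0. \<exists>k. \<forall>n. birkhoff_sum T (u k) n x \<le> \<delta> * real n"
proof -
  have [measurable]: "u k \<in> borel_measurable M" for k using u by simp
  have one: "AE x in M. \<exists>k. \<forall>n. birkhoff_sum T (u k) n x \<le> \<delta> * real n" if \<delta>: "\<delta> > 0" for \<delta>
  proof -
    define A where "A k = {x\<in>space M. \<exists>n. \<delta> * real n < birkhoff_sum T (u k) n x}" for k
    have [measurable]: "A k \<in> sets M" for k unfolding A_def by measurable
    have bound: "\<delta> * prob (A k) \<le> (\<integral>x. u k x \<partial>M)" for k
    proof -
      have shift: "birkhoff_sum T (\<lambda>x. u k x - \<delta>) n x = birkhoff_sum T (u k) n x - \<delta> * real n" for n x
        by (simp add: birkhoff_sum_def sum_subtractf)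
      have "0 \<le> (\<integral>x. (u k x - \<delta>) * indicator {x. \<exists>n. 0 < birkhoff_sum T (\<lambda>x. u k x - \<delta>) n x} x \<partial>M)"
        by (rule maximal_ergodic) (use u in auto)
      also have "\<dots> = (\<integral>x. (u k x - \<delta>) * indicator (A k) x \<partial>M)"
        by (rule Bochner_Integration.integral_cong[OF refl])
          (auto simp: A_def shift indicator_def)
      also have "\<dots> = (\<integral>x. u k x * indicator (A k) x - \<delta> * indicator (A k) x \<partial>M)"
        by (simp add: left_diff_distrib)
      also have "\<dots> = (\<integral>x. u k x * indicator (A k) x \<partial>M) - \<delta> * prob (A k)"
        by (subst Bochner_Integration.integral_diff)
          (auto intro!: integrable_real_mult_indicator u simp: less_top[symmetric])
      also have "\<dots> \<le> (\<integral>x. u k x \<partial>M) - \<delta> * prob (A k)"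
        using nonneg[of k]
        by (intro diff_right_mono integral_mono integrable_real_mult_indicator u)
          (auto simp: indicator_def)
      finally show ?thesis by simp
    qed
    have "prob (\<Inter>k. A k) \<le> (\<integral>x. u k x \<partial>M) / \<delta>" for k
    proof -
      have "prob (\<Inter>k. A k) \<le> prob (A k)" by (intro finite_measure_mono) auto
      then show ?thesis using bound[of k] \<delta> by (simp add: field_simps) (smt (verit) mult_left_mono)
    qed
    moreover have "(\<lambda>k. (\<integral>x. u k x \<partial>M) / \<delta>) \<longlonglongrightarrow> 0 / \<delta>" using lim \<delta> by (intro tendsto_divide) auto
    ultimately have "prob (\<Inter>k. A k) \<le> 0"
      by (intro tendsto_lowerbound[where F = sequentially]) auto
    then have "emeasure M (\<Inter>k. A k) = 0"
      by (simp add: emeasure_eq_measure measure_le_0_iff)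
    then have "AE x in M. x \<notin> (\<Inter>k. A k)"
      by (intro AE_not_in) (auto intro!: null_setsI sets.countable_INT)
    then show ?thesis
      using AE_space by eventually_elim (auto simp: A_def not_less)
  qed
  have "AE x in M. \<forall>m::nat. \<exists>k. \<forall>n. birkhoff_sum T (u k) n x \<le> (1 / Suc m) * real n"
    unfolding AE_all_countable by (intro allI one) simp
  then show ?thesis
  proof eventually_elim
    case (elim x)
    show ?case
    proof (intro allI impI)
      fix \<delta> :: real assume "\<delta> > 0"
      then obtain m where m: "1 / real (Suc m) < \<delta>" using nat_approx_posE by blast
      from elim obtain k where k: "\<And>n. birkhoff_sum T (u k) n x \<le> (1 / Suc m) * real n" by blast
      have "(1 / Suc m) * real n \<le> \<delta> * real n" for n using m by (intro mult_right_mono) auto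
      then show "\<exists>k. \<forall>n. birkhoff_sum T (u k) n x \<le> \<delta> * real n" using k order_trans by blast
    qed
  qed
qed

text \<open>With \<open>c\<close> a third of the probability of \<open>E\<close>, consider the event that infinitely often there are fewer
than \<open>c * n + B\<close> visits, for some \<open>B\<close>. Allowing an arbitrary \<open>B\<close> makes the event exactly
invariant. If it had full measure, the maximal ergodic inequality for \<open>2 * c - indicator E\<close>
would give \<open>prob E \<le> 2 * c\<close>.\<close>

lemma ergodic_visits:
  assumes erg: "\<And>A. A \<in> sets M \<Longrightarrow> (\<And>x. x \<in> space M \<Longrightarrow> x \<in> A \<longleftrightarrow> T x \<in> A) \<Longrightarrow> prob A \<in> {0, 1}"
    and E [measurable]: "E \<in> sets M" and pos: "prob E > 0"
  shows "\<exists>c>0. AE x in M. \<forall>B::nat. \<forall>\<^sub>F n in sequentially.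
    c * real n + real B \<le> birkhoff_sum T (indicator E) n x"
proof -
  define c where "c = prob E / 3"
  let ?S = "birkhoff_sum T (indicator E)"
  define A where "A = {x\<in>space M. \<exists>B::nat. \<forall>N. \<exists>n\<ge>N. ?S n x < c * real n + real B}"
  have A[measurable]: "A \<in> sets M" unfolding A_def by measurable
  have c: "0 < c" using pos by (simp add: c_def)
  have TM: "T x \<in> space M" if "x \<in> space M" for x using that measurable_space[OF T_measurable] by blast
  have "x \<in> A \<longleftrightarrow> T x \<in> A" if x: "x \<in> space M" for x
  proof
    assume "x \<in> A"
    then obtain B where B: "\<And>N. \<exists>n\<ge>N. ?S n x < c * real n + real B" by (auto simp: A_def)
    have "\<exists>n\<ge>N. ?S n (T x) < c * real n + real (B + nat \<lceil>c\<rceil>)" for N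
    proof -
      obtain n where n: "n \<ge> Suc N" "?S n x < c * real n + real B" using B by blast
      then obtain k where k: "n = Suc k" by (cases n) auto
      have "?S k (T x) \<le> ?S n x" unfolding k birkhoff_sum_Suc by (simp add: indicator_def)
      moreover have "c \<le> real (nat \<lceil>c\<rceil>)" by linarith
      ultimately have "?S k (T x) < c * real k + real (B + nat \<lceil>c\<rceil>)"
        using n(2) unfolding k by (simp add: algebra_simps)
      then show ?thesis using n(1) k by auto
    qed
    then show "T x \<in> A" using TM[OF x] unfolding A_def by blast
  next
    assume "T x \<in> A"
    then obtain B where B: "\<And>N. \<exists>n\<ge>N. ?S n (T x) < c * real n + real B" by (auto simp: A_def)
    have "\<exists>n\<ge>N. ?S n x < c * real n + real (Suc B)" for N
    proof -
      obtain n where n: "n \<ge> N" "?S n (T x) < c * real n + real B" using B by blast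
      have "?S (Suc n) x \<le> 1 + ?S n (T x)" unfolding birkhoff_sum_Suc by (simp add: indicator_def)
      then have "?S (Suc n) x < c * real (Suc n) + real (Suc B)"
        using n(2) c by (simp add: algebra_simps)
      then show ?thesis using n(1) by (intro exI[of _ "Suc n"]) auto
    qed
    then show "x \<in> A" using x unfolding A_def by blast
  qed
  then have "prob A \<in> {0, 1}" using erg[OF A] by blast
  moreover have "prob A \<noteq> 1"
  proof
    assume "prob A = 1"
    then have AA: "AE x in M. x \<in> A" using AE_in_set_eq_1[OF A] by blast
    let ?u = "\<lambda>x. 2 * c - indicator E x :: real"
    have iE: "integrable M (\<lambda>x. indicator E x :: real)" by (auto simp: less_top[symmetric])
    have shift: "birkhoff_sum T ?u n x = 2 * c * real n - ?S n x" for n x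
      by (simp add: birkhoff_sum_def sum_subtractf)
    have "0 \<le> (\<integral>x. ?u x * indicator {x. \<exists>n. 0 < birkhoff_sum T ?u n x} x \<partial>M)"
      using iE by (intro maximal_ergodic) auto
    also have "\<dots> = (\<integral>x. ?u x \<partial>M)"
    proof (rule integral_cong_AE)
      have "{x\<in>space M. \<exists>n. 0 < birkhoff_sum T ?u n x} \<in> sets M" by measurable
      then have "(\<lambda>x. ?u x * indicator {x\<in>space M. \<exists>n. 0 < birkhoff_sum T ?u n x} x) \<in> borel_measurable M"
        by measurable
      then show "(\<lambda>x. ?u x * indicator {x. \<exists>n. 0 < birkhoff_sum T ?u n x} x) \<in> borel_measurable M"
        by (rule measurable_cong[THEN iffD1, rotated]) (simp add: indicator_def)
      show "?u \<in> borel_measurable M" by measurable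
      show "AE x in M. ?u x * indicator {x. \<exists>n. 0 < birkhoff_sum T ?u n x} x = ?u x"
        using AA
      proof eventually_elim
        case (elim x)
        then obtain B where B: "\<And>N. \<exists>n\<ge>N. ?S n x < c * real n + real B" by (auto simp: A_def)
        obtain N where N: "real B / c < real N" using reals_Archimedean2 by blast
        obtain n where n: "n \<ge> N" "?S n x < c * real n + real B" using B by blast
        have "real B < c * real N" using N c by (simp add: field_simps)
        also have "\<dots> \<le> c * real n" using n(1) c by simp
        finally have "0 < birkhoff_sum T ?u n x" using n(2) unfolding shift by simp
        then show ?case by (auto simp: indicator_def)
      qed
    qed
    also have "\<dots> = 2 * c - prob E"
      using iE by (simp add: prob_space)
    finally show False using pos by (simp add: c_def)
  qed
  ultimately have "prob A = 0" by blast
  then have "AE x in M. x \<notin> A"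
    by (intro AE_not_in) (auto simp: null_sets_def emeasure_eq_measure)
  then have "AE x in M. \<forall>B::nat. \<forall>\<^sub>F n in sequentially. c * real n + real B \<le> ?S n x"
    using AE_space
  proof eventually_elim
    case (elim x)
    show ?case
    proof
      fix B :: nat
      from elim have "\<not> (\<forall>N. \<exists>n\<ge>N. ?S n x < c * real n + real B)" by (auto simp: A_def)
      then show "\<forall>\<^sub>F n in sequentially. c * real n + real B \<le> ?S n x"
        unfolding eventually_sequentially by (meson not_less)
    qed
  qed
  then show ?thesis using c by blast
qed

end

section \<open>Frequency of local minima\<close>

context measure_preserving begin

text \<open>The increment along \<open>T\<close> is nonnegative and has integral zero.\<close>

lemma invariant_of_mono:
  fixes u :: "'a \<Rightarrow> real"
  assumes u: "integrable M u" and le: "AE x in M. u x \<le> u (T x)"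
  shows "AE x in M. u (T x) = u x"
proof -
  have int: "integrable M (\<lambda>x. u (T x) - u x)" using integrable_T(1)[OF u] u by simp
  have "(\<integral>x. u (T x) - u x \<partial>M) = 0" using integrable_T[OF u] u by simp
  then have "AE x in M. u (T x) - u x = 0"
    using integral_nonneg_eq_0_iff_AE[OF int] le by auto
  then show ?thesis by eventually_elim simp
qed

lemma AE_T:
  assumes "AE x in M. Q x"
  shows "AE x in M. Q (T x)"
  by (rule AE_distrD[OF T_measurable]) (subst distr_T, rule assms)

end

definition shift :: "(nat \<Rightarrow> real) \<Rightarrow> nat \<Rightarrow> real" where
  "shift x = (\<lambda>i. x (Suc i))"

lemma shift_funpow: "(shift ^^ k) x = (\<lambda>i. x (k + i))"
  by (induction k arbitrary: x) (simp_all add: shift_def)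

lemma shift_measurable: "shift \<in> measurable seq_algebra seq_algebra"
  unfolding shift_def by (rule measurable_PiM_single') (auto simp: space_PiM)

lemma seq_from_measurable:
  assumes "\<And>i. i \<ge> 1 \<Longrightarrow> X i \<in> borel_measurable P" "k \<ge> 1"
  shows "seq_from X k \<in> measurable P seq_algebra"
  unfolding seq_from_def using assms by (intro measurable_PiM_single') (auto simp: space_PiM)

definition local_min :: "(nat \<Rightarrow> real) set" where
  "local_min = {x. x 1 < x 0 \<and> x 1 < x 2}"

lemma coordinate_measurable [measurable]: "(\<lambda>x. x i) \<in> borel_measurable seq_algebra"
  by (rule measurable_component_singleton) simp

lemma local_min_measurable: "local_min \<in> sets seq_algebra"
proof -
  have "{x \<in> space seq_algebra. x 1 < x 0 \<and> x 1 < x 2} \<in> sets seq_algebra" by measurable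
  then show ?thesis by (simp add: local_min_def space_PiM)
qed

text \<open>Without local minima the event that the sequence starts with a descent is invariant, hence trivial,
and so the sequence almost surely starts with a strict descent or almost surely with a strict
ascent. Composing with the bounded, strictly increasing \<open>arctan\<close> gives integrable functions of
the first two coordinates that are strictly ordered but have the same integral.\<close>

lemma prob_local_min_pos:
  fixes \<mu> :: "(nat \<Rightarrow> real) measure"
  assumes mp: "measure_preserving \<mu> shift" and sets: "sets \<mu> = sets seq_algebra"
    and erg: "\<And>A. A \<in> sets \<mu> \<Longrightarrow> (AE x in \<mu>. x \<in> A \<longleftrightarrow> shift x \<in> A) \<Longrightarrow> measure \<mu> A \<in> {0, 1}"
    and ne: "AE x in \<mu>. x 0 \<noteq> x (1::nat)"
  shows "measure \<mu> local_min > 0"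
proof (rule ccontr)
  interpret measure_preserving \<mu> shift by (rule mp)
  have space: "space \<mu> = UNIV" using sets_eq_imp_space_eq[OF sets] by (simp add: space_PiM)
  note [measurable_cong] = sets
  have lm [measurable]: "local_min \<in> sets \<mu>" using local_min_measurable sets by simp
  define D where "D = {x \<in> space \<mu>. x (1::nat) < x 0}"
  have D [measurable]: "D \<in> sets \<mu>" unfolding D_def by measurable
  assume "\<not> measure \<mu> local_min > 0"
  then have "emeasure \<mu> local_min = 0"
    by (simp add: emeasure_eq_measure not_less measure_le_0_iff)
  then have nolm: "AE x in \<mu>. x \<notin> local_min"
    by (intro AE_not_in) (auto simp: null_sets_def)
  \<comment> \<open>Without local minima a descent is followed by a descent.\<close>
  have "AE x in \<mu>. (indicator D x :: real) \<le> indicator D (shift x)"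
    using nolm AE_T[OF ne]
  proof eventually_elim
    case (elim x)
    then show ?case
      by (auto simp: D_def space local_min_def shift_def indicator_def numeral_2_eq_2)
  qed
  moreover have "integrable \<mu> (indicator D :: _ \<Rightarrow> real)" by (auto simp: less_top[symmetric])
  ultimately have "AE x in \<mu>. (indicator D (shift x) :: real) = indicator D x"
    by (intro invariant_of_mono)
  then have "AE x in \<mu>. x \<in> D \<longleftrightarrow> shift x \<in> D"
    by eventually_elim (auto simp: indicator_def split: if_splits)
  then have D01: "prob D \<in> {0, 1}" by (rule erg[OF D])
  have no_strict: False
    if mono: "AE x in \<mu>. s * arctan (x 0) < s * arctan (x (1::nat))" for s :: real
  proof -
    have "integrable \<mu> (\<lambda>x. s * arctan (x 0))"
    proof (rule integrable_const_bound[of _ "\<bar>s\<bar> * (pi / 2)"])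
      show "AE x in \<mu>. norm (s * arctan (x 0)) \<le> \<bar>s\<bar> * (pi / 2)"
      proof (rule AE_I2)
        fix x :: "nat \<Rightarrow> real"
        have "\<bar>arctan (x 0)\<bar> \<le> pi / 2" using arctan_bounded[of "x 0"] by linarith
        then show "norm (s * arctan (x 0)) \<le> \<bar>s\<bar> * (pi / 2)"
          by (simp only: real_norm_def abs_mult) (rule mult_left_mono, simp_all)
      qed
    qed measurable
    then have "AE x in \<mu>. s * arctan (shift x 0) = s * arctan (x 0)"
      using mono by (intro invariant_of_mono) (auto simp: shift_def elim: eventually_mono)
    then have "AE x in \<mu>. False"
      using mono by eventually_elim (auto simp: shift_def)
    then show False by simp
  qed
  from D01 consider "prob D = 0" | "prob D = 1" by blast
  then show False
  proof cases
    case 1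
    then have "AE x in \<mu>. x \<notin> D"
      by (intro AE_not_in) (auto simp: null_sets_def emeasure_eq_measure)
    then have "AE x in \<mu>. 1 * arctan (x 0) < 1 * arctan (x (1::nat))"
      using ne by eventually_elim (auto simp: D_def space arctan_less_iff)
    then show False by (rule no_strict)
  next
    case 2
    then have "AE x in \<mu>. x \<in> D" using AE_in_set_eq_1[OF D] by blast
    then have "AE x in \<mu>. -1 * arctan (x 0) < -1 * arctan (x (1::nat))"
      by eventually_elim (simp add: D_def arctan_less_iff)
    then show False by (rule no_strict)
  qed
qed

text \<open>Sequences are shifted by one here because the variables are numbered from 1. The correction 2 is for the last two
positions, whose neighbours may lie beyond \<open>n\<close>.\<close>

lemma birkhoff_sum_local_min:
  "birkhoff_sum shift (indicator local_min) n (\<lambda>i. x (Suc i)) \<le>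
    real (card {k. k + 3 \<le> n \<and> x (k + 2) < x (k + 1) \<and> x (k + 2) < x (k + 3)}) + 2"
proof -
  let ?L = "{k. x (k + 2) < x (k + 1) \<and> x (k + 2) < x (k + 3)}"
  let ?M = "{k. k + 3 \<le> n \<and> x (k + 2) < x (k + 1) \<and> x (k + 2) < x (k + 3)}"
  have "birkhoff_sum shift (indicator local_min) n (\<lambda>i. x (Suc i)) = (\<Sum>k<n. indicator ?L k)"
    unfolding birkhoff_sum_def
    by (intro sum.cong) (auto simp: shift_funpow local_min_def indicator_def eval_nat_numeral)
  also have "\<dots> = real (card ({..<n} \<inter> ?L))" by (simp add: indicator_def)
  finally have eq: "birkhoff_sum shift (indicator local_min) n (\<lambda>i. x (Suc i)) =
    real (card ({..<n} \<inter> ?L))" .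
  have "card ({..<n} \<inter> ?L) \<le> card (?M \<union> {n - 2, n - 1})"
  proof (rule card_mono)
    show "finite (?M \<union> {n - 2, n - 1})" by (auto intro: finite_subset[of _ "{..n}"])
  qed auto
  also have "\<dots> \<le> card ?M + card {n - 2, n - 1}" by (rule card_Un_le)
  also have "\<dots> \<le> card ?M + 2" by (simp add: card_insert_if)
  finally have "real (card ({..<n} \<inter> ?L)) \<le> real (card ?M + 2)" by (rule of_nat_mono)
  then show ?thesis unfolding eq by simp
qed

lemma birkhoff_sum_coordinate:
  "birkhoff_sum shift (\<lambda>x. \<phi> (x 0)) n (\<lambda>i. x (Suc i)) = (\<Sum>i=1..n. \<phi> (x i))"
proof -
  have "(\<Sum>i=1..n. \<phi> (x i)) = (\<Sum>k<n. \<phi> (x (Suc k)))"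
    by (rule sum.reindex_bij_witness[of _ Suc "\<lambda>i. i - 1"]) auto
  then show ?thesis by (simp add: birkhoff_sum_def shift_funpow)
qed

section \<open>Convergence of averages over a barcode\<close>

definition tail_part :: "(real \<Rightarrow> real) \<Rightarrow> nat \<Rightarrow> real \<Rightarrow> real" where
  "tail_part g k a = (if real k < 2 * \<bar>a\<bar> then g (2 * \<bar>a\<bar>) else 0)"

lemma g_abs_measurable:
  assumes "continuous_on {0..} (g :: real \<Rightarrow> real)"
  shows "(\<lambda>a. g (2 * \<bar>a\<bar>)) \<in> borel_measurable borel"
proof (rule borel_measurable_continuous_onI)
  show "continuous_on UNIV (\<lambda>a. g (2 * \<bar>a\<bar>))"
    by (rule continuous_on_compose2[OF assms]) (auto intro!: continuous_intros)
qed

lemma tilde_Delta_function_continuous: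
  assumes f: "\<And>b d. b < d \<Longrightarrow> f (ereal b, ereal d) = g (d - b :: real)"
    and g: "continuous_on {0..} (g :: real \<Rightarrow> real)"
  shows "continuous_on tilde_Delta f"
proof -
  let ?l = "\<lambda>z :: ereal \<times> ereal. real_of_ereal (snd z) - real_of_ereal (fst z)"
  have "continuous_on tilde_Delta (\<lambda>z. real_of_ereal (snd z))"
    by (rule continuous_on_compose2[OF continuous_on_real]) (auto intro!: continuous_intros simp: tilde_Delta_iff)
  moreover have "continuous_on tilde_Delta (\<lambda>z. real_of_ereal (fst z))"
    by (rule continuous_on_compose2[OF continuous_on_real]) (auto intro!: continuous_intros simp: tilde_Delta_iff)
  ultimately have "continuous_on tilde_Delta ?l" by (rule continuous_on_diff)
  then have "continuous_on tilde_Delta (\<lambda>z. g (?l z))"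
    by (rule continuous_on_compose2[OF g]) (auto simp: tilde_Delta_iff)
  then show ?thesis
    by (rule continuous_on_cong[THEN iffD1, OF refl, rotated]) (auto simp: tilde_Delta_iff f)
qed

text \<open>If \<open>g (d - b)\<close> exceeds \<open>C\<close>, then \<open>d - b\<close> lies beyond both the threshold \<open>k\<close> and the point \<open>r\<close> from which
\<open>g\<close> is monotone, and so does the larger of \<open>2 * \<bar>b\<bar>\<close> and \<open>2 * \<bar>d\<bar>\<close>.\<close>

lemma truncation_error_le:
  assumes mono: "mono_on {r..} g" and nonneg: "\<And>y. 0 \<le> y \<Longrightarrow> 0 \<le> g y"
    and C: "\<And>y. 0 \<le> y \<Longrightarrow> y \<le> max r (real k) \<Longrightarrow> g y \<le> C" and bd: "b < d"
  shows "g (d - b) - min (g (d - b)) C \<le> tail_part g k b + tail_part g k d"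
proof (cases "g (d - b) \<le> C")
  case True
  then show ?thesis by (simp add: tail_part_def nonneg)
next
  case False
  then have big: "max r (real k) < d - b" using C[of "d - b"] bd by force
  have "0 \<le> C"
    using C[of 0] nonneg[of 0] by (simp add: max.coboundedI2)
  have g_le: "g (d - b) \<le> tail_part g k a" if "d - b \<le> 2 * \<bar>a\<bar>" for a
  proof -
    have "g (d - b) \<le> g (2 * \<bar>a\<bar>)" using big that by (intro mono_onD[OF mono]) auto
    then show ?thesis using big that by (simp add: tail_part_def)
  qed
  have "d - b \<le> 2 * \<bar>b\<bar> \<or> d - b \<le> 2 * \<bar>d\<bar>" by linarith
  moreover have "0 \<le> tail_part g k b" "0 \<le> tail_part g k d" by (auto simp: tail_part_def nonneg)
  ultimately have "g (d - b) \<le> tail_part g k b + tail_part g k d" using g_le[of b] g_le[of d] by linarith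
  then show ?thesis using False \<open>0 \<le> C\<close> by simp
qed

text \<open>The part of the argument that concerns a single sequence. The distance of the averages of \<open>f\<close> from
\<open>\<integral>z. f z \<partial>\<xi>\<close> is split into the truncation error of the averages, their weak convergence for the
truncated function, and the truncation error of the limit.\<close>

lemma barcode_average_converges:
  fixes x :: "nat \<Rightarrow> real" and \<xi> :: "(ereal \<times> ereal) measure"
  assumes f: "\<And>b d. b < d \<Longrightarrow> f (ereal b, ereal d) = g (d - b)"
    and gpos: "\<And>y. y \<ge> 0 \<Longrightarrow> g y \<ge> 0" and gcont: "continuous_on {0..} g"
    and mono: "mono_on {r..} g"
    and c: "c > 0" "\<forall>\<^sub>F n in sequentially. c * real n \<le> real (card (mortal_bars x n))"
    and tail: "\<forall>\<delta>>0. \<exists>k. \<forall>n. (\<Sum>i=1..n. tail_part g k (x i)) \<le> \<delta> * real n"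
    and weak: "converges_weakly (\<lambda>n. normalized (tilde_xi0 x n)) \<xi>"
    and sets: "sets \<xi> = sets (restrict_space borel tilde_Delta)"
    and prob: "prob_space \<xi>"
    and fin: "(\<integral>\<^sup>+z. ennreal (f z) \<partial>\<xi>) < \<infinity>"
  shows "(\<lambda>n. (\<integral>z. f z \<partial>tilde_xi0 x n) / measure (tilde_xi0 x n) tilde_Delta) \<longlonglongrightarrow> (\<integral>z. f z \<partial>\<xi>)"
proof -
  interpret \<xi>: prob_space \<xi> by (rule prob)
  have space: "space \<xi> = tilde_Delta"
    using sets_eq_imp_space_eq[OF sets] by (simp add: space_restrict_space)
  have fcont: "continuous_on tilde_Delta f" by (rule tilde_Delta_function_continuous[OF f gcont])
  have fR: "f \<in> borel_measurable (restrict_space borel tilde_Delta)"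
    by (rule borel_measurable_continuous_on_restrict[OF fcont])
  have fpos: "0 \<le> f z" if "z \<in> tilde_Delta" for z
    using that f gpos by (auto simp: tilde_Delta_iff)
  have f\<xi>: "f \<in> borel_measurable \<xi>" using fR by (simp cong: measurable_cong_sets add: sets)
  have fint: "integrable \<xi> f"
    using f\<xi> fin fpos by (intro integrableI_nonneg) (auto simp: space)
  let ?B = "mortal_bars x"
  define avg where "avg h n = (\<Sum>i\<in>?B n. h (bar x n i)) / real (card (?B n))" for h n
  define fm where "fm m z = min (f z) (real m)" for m z
  have fmcont: "continuous_on tilde_Delta (fm m)" for m
    unfolding fm_def by (intro continuous_on_min fcont continuous_on_const)
  have ne: "\<forall>\<^sub>F n in sequentially. ?B n \<noteq> {}"
    using c(2) eventually_gt_at_top[of 0]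
  proof eventually_elim
    case (elim n)
    then have "0 < real (card (?B n))" using c(1) by (smt (verit) mult_pos_pos of_nat_0_less_iff)
    then show ?case by auto
  qed
  have lim_m: "avg (fm m) \<longlonglongrightarrow> (\<integral>z. fm m z \<partial>\<xi>)" for m
  proof -
    have "bounded (fm m ` tilde_Delta)"
      unfolding bounded_iff using fpos by (intro exI[of _ "real m"]) (auto simp: fm_def)
    then have "(\<lambda>n. \<integral>z. fm m z \<partial>normalized (tilde_xi0 x n)) \<longlonglongrightarrow> (\<integral>z. fm m z \<partial>\<xi>)"
      using weak fmcont unfolding converges_weakly_def space by blast
    moreover have "\<forall>\<^sub>F n in sequentially. (\<integral>z. fm m z \<partial>normalized (tilde_xi0 x n)) = avg (fm m) n"
      using ne
    proof eventually_elim
      case (elim n)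
      then show ?case unfolding avg_def
        by (intro integral_normalized_tilde_xi0 borel_measurable_continuous_on_restrict fmcont)
    qed
    ultimately show ?thesis by (rule Lim_transform_eventually)
  qed
  have lim_int: "(\<lambda>m. \<integral>z. fm m z \<partial>\<xi>) \<longlonglongrightarrow> (\<integral>z. f z \<partial>\<xi>)"
  proof (rule integral_dominated_convergence[where w = f])
    show "AE z in \<xi>. (\<lambda>m. fm m z) \<longlonglongrightarrow> f z"
    proof (rule AE_I2, rule tendsto_eventually)
      fix z
      obtain m0 where "f z \<le> real m0" using real_arch_simple by blast
      show "\<forall>\<^sub>F m in sequentially. fm m z = f z"
        using eventually_ge_at_top[of m0]
        by eventually_elim (use \<open>f z \<le> real m0\<close> in \<open>auto simp: fm_def\<close>)
    qed
    show "AE z in \<xi>. norm (fm m z) \<le> f z" for m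
      using fpos by (intro AE_I2) (auto simp: fm_def space)
    show "fm m \<in> borel_measurable \<xi>" for m
      unfolding fm_def using f\<xi> by measurable
  qed (use f\<xi> fint in auto)
  have "avg f \<longlonglongrightarrow> (\<integral>z. f z \<partial>\<xi>)"
  proof (rule LIMSEQ_I)
    fix \<eta> :: real assume \<eta>: "0 < \<eta>"
    \<comment> \<open>The excess is at most three tail sums, to be divided by at least \<open>c * n\<close> bars.\<close>
    have "0 < c * \<eta> / 9" using c \<eta> by simp
    with tail obtain k where k: "\<And>n. (\<Sum>i=1..n. tail_part g k (x i)) \<le> (c * \<eta> / 9) * real n" by blast
    have "compact (g ` {0..max r (real k)})"
      by (intro compact_continuous_image continuous_on_subset[OF gcont]) auto
    then obtain C where C: "\<And>y. 0 \<le> y \<Longrightarrow> y \<le> max r (real k) \<Longrightarrow> g y \<le> C"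
      using compact_imp_bounded bounded_imp_bdd_above unfolding bdd_above_def by fastforce
    have "\<forall>\<^sub>F m in sequentially. C \<le> real m \<and> \<bar>(\<integral>z. fm m z \<partial>\<xi>) - (\<integral>z. f z \<partial>\<xi>)\<bar> < \<eta> / 3"
    proof (rule eventually_conj)
      show "\<forall>\<^sub>F m in sequentially. C \<le> real m"
        using eventually_ge_at_top[of "nat \<lceil>C\<rceil>"] by eventually_elim linarith
      show "\<forall>\<^sub>F m in sequentially. \<bar>(\<integral>z. fm m z \<partial>\<xi>) - (\<integral>z. f z \<partial>\<xi>)\<bar> < \<eta> / 3"
        using tendstoD[OF lim_int, of "\<eta> / 3"] \<eta> by (simp add: dist_real_def)
    qed
    then obtain m where m: "C \<le> real m" "\<bar>(\<integral>z. fm m z \<partial>\<xi>) - (\<integral>z. f z \<partial>\<xi>)\<bar> < \<eta> / 3"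
      using eventually_happens' sequentially_bot by blast
    have error: "\<bar>avg f n - avg (fm m) n\<bar> \<le> \<eta> / 3"
      if n: "c * real n \<le> real (card (?B n))" "?B n \<noteq> {}" for n
    proof -
      have diff: "0 \<le> f (bar x n i) - fm m (bar x n i) \<and> f (bar x n i) - fm m (bar x n i) \<le>
          tail_part g k (x i) + tail_part g k (real_of_ereal (death x n i))" if i: "i \<in> ?B n" for i
      proof -
        have "bar x n i \<in> tilde_Delta"
          using bar_in_tilde_Delta[of i x n] i by (auto simp: mortal_bars_def)
        then obtain d where d: "death x n i = ereal d" "x i < d" by (auto simp: tilde_Delta_iff bar_def)
        have "g (d - x i) - min (g (d - x i)) (real m) \<le> tail_part g k (x i) + tail_part g k d"
          using C m(1) by (intro truncation_error_le[OF mono gpos _ d(2)]) (auto intro: order_trans)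
        then show ?thesis using d by (simp add: bar_def fm_def f)
      qed
      have pos: "0 < real (card (?B n))" using n(2) by (simp add: card_gt_0_iff)
      have tp: "0 \<le> tail_part g k a" for a by (simp add: tail_part_def gpos)
      have "avg f n - avg (fm m) n = (\<Sum>i\<in>?B n. f (bar x n i) - fm m (bar x n i)) / real (card (?B n))"
        by (simp add: avg_def sum_subtractf diff_divide_distrib)
      moreover have "0 \<le> (\<Sum>i\<in>?B n. f (bar x n i) - fm m (bar x n i))"
        using diff by (intro sum_nonneg) blast
      moreover have "(\<Sum>i\<in>?B n. f (bar x n i) - fm m (bar x n i)) \<le> (\<eta> / 3) * real (card (?B n))"
      proof -
        have "(\<Sum>i\<in>?B n. f (bar x n i) - fm m (bar x n i)) \<le>
            (\<Sum>i\<in>?B n. tail_part g k (x i) + tail_part g k (real_of_ereal (death x n i)))"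
          using diff by (intro sum_mono) blast
        also have "\<dots> \<le> 3 * (\<Sum>i=1..n. tail_part g k (x i))"
          using sum_births_le[of "tail_part g k" x n, OF tp] sum_deaths_le[of "tail_part g k" x n, OF tp]
          by (simp add: sum.distrib)
        also have "\<dots> \<le> 3 * ((c * \<eta> / 9) * real n)" using k[of n] by linarith
        also have "\<dots> = (\<eta> / 3) * (c * real n)" by simp
        also have "\<dots> \<le> (\<eta> / 3) * real (card (?B n))" using n(1) \<eta> by (intro mult_left_mono) auto
        finally show ?thesis .
      qed
      ultimately show ?thesis using pos by (simp add: pos_divide_le_eq)
    qed
    have "\<forall>\<^sub>F n in sequentially. \<bar>avg (fm m) n - (\<integral>z. fm m z \<partial>\<xi>)\<bar> < \<eta> / 3"
      using tendstoD[OF lim_m[of m], of "\<eta> / 3"] \<eta> by (simp add: dist_real_def)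
    then have "\<forall>\<^sub>F n in sequentially. norm (avg f n - (\<integral>z. f z \<partial>\<xi>)) < \<eta>"
      using c(2) ne
    proof eventually_elim
      case (elim n)
      show ?case
        using error[OF elim(2,3)] elim(1) m(2) unfolding real_norm_def by linarith
    qed
    then show "\<exists>no. \<forall>n\<ge>no. norm (avg f n - (\<integral>z. f z \<partial>\<xi>)) < \<eta>"
      by (simp add: eventually_sequentially)
  qed
  moreover have "(\<integral>z. f z \<partial>tilde_xi0 x n) / measure (tilde_xi0 x n) tilde_Delta = avg f n" for n
    by (simp add: avg_def integral_tilde_xi0[OF fR] measure_tilde_xi0)
  ultimately show ?thesis by simp
qed

theorem theorem3p8:
  fixes P :: "'w measure"
    and X :: "nat \<Rightarrow> 'w \<Rightarrow> real"
    and F :: "real \<Rightarrow> real"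
    and \<xi> :: "(ereal \<times> ereal) measure"
    and f :: "ereal \<times> ereal \<Rightarrow> real"
    and g :: "real \<Rightarrow> real"
    and \<epsilon> :: real
  assumes "prob_space P"
    and "\<And>i. i \<ge> 1 \<Longrightarrow> X i \<in> borel_measurable P"
    and "stationary P X"
    and "ergodic P X"
    and "\<And>i. i \<ge> 1 \<Longrightarrow> cdf (distr P borel (X i)) = F"
    and "\<And>i. i \<ge> 1 \<Longrightarrow> \<exists>p. distributed P lborel (X i) p"
    and "measure P {\<omega>\<in>space P. X 1 \<omega> = X 2 \<omega>} = 0"
    and "prob_space \<xi>"
    and "sets \<xi> = sets (restrict_space borel tilde_Delta)"
    and "AE \<omega> in P. converges_weakly (\<lambda>n. normalized (tilde_xi0 (\<lambda>k. X k \<omega>) n)) \<xi>"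
    and "\<And>b d. b < d \<Longrightarrow> f (ereal b, ereal d) = g (d - b)"
    and "\<And>x. x \<ge> 0 \<Longrightarrow> g x \<ge> 0"
    and "continuous_on {0..} g"
    and "coercive g"
    and "largely_nondecreasing g"
    and "\<epsilon> > 0"
    and "(\<integral>\<^sup>+\<omega>. ennreal (g (2 * \<bar>X 1 \<omega>\<bar>) powr (1 + \<epsilon>)) \<partial>P) < \<infinity>"
    and "(\<integral>\<^sup>+z. ennreal (f z) \<partial>\<xi>) < \<infinity>"
  shows "AE \<omega> in P.
    (\<lambda>n. (\<integral>z. f z \<partial>tilde_xi0 (\<lambda>k. X k \<omega>) n) / measure (tilde_xi0 (\<lambda>k. X k \<omega>) n) tilde_Delta)
      \<longlonglongrightarrow> (\<integral>z. f z \<partial>\<xi>)"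
proof -
  note X = assms(2) and gpos = assms(12) and gcont = assms(13)
  interpret P: prob_space P by (rule assms(1))
  have X1 [measurable]: "X 1 \<in> borel_measurable P" "X 2 \<in> borel_measurable P" using X by auto
  let ?Y = "\<lambda>\<omega> i. X (Suc i) \<omega>"
  have seq1: "seq_from X 1 = ?Y" by (simp add: seq_from_def)
  have seq2: "seq_from X 2 \<omega> = shift (?Y \<omega>)" for \<omega> by (simp add: seq_from_def shift_def)
  have Ym [measurable]: "?Y \<in> measurable P seq_algebra"
    using seq_from_measurable[of X P 1] X unfolding seq1 by simp
  \<comment> \<open>On the space of sequences the passage of time is the shift map, which preserves the law \<open>\<mu>\<close>.\<close>
  define \<mu> where "\<mu> = distr P seq_algebra ?Y"
  have sets\<mu>: "sets \<mu> = sets seq_algebra" by (simp add: \<mu>_def)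
  have Ym\<mu>: "?Y \<in> measurable P \<mu>" using Ym by (simp add: measurable_cong_sets[OF refl sets\<mu>])
  have mp: "measure_preserving \<mu> shift"
  proof (intro measure_preserving.intro measure_preserving_axioms.intro)
    show "prob_space \<mu>" unfolding \<mu>_def by (rule P.prob_space_distr[OF Ym])
    show "shift \<in> measurable \<mu> \<mu>"
      using shift_measurable by (simp add: measurable_cong_sets[OF sets\<mu> sets\<mu>])
    have "distr \<mu> \<mu> shift = distr \<mu> seq_algebra shift" by (rule distr_cong) (simp_all add: sets\<mu>)
    also have "\<dots> = distr P seq_algebra (shift \<circ> ?Y)"
      unfolding \<mu>_def by (rule distr_distr[OF shift_measurable Ym])
    also have "shift \<circ> ?Y = seq_from X 2" using seq2 by (simp add: fun_eq_iff)
    also have "distr P seq_algebra (seq_from X 2) = distr P seq_algebra (seq_from X 1)"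
      by (rule assms(3)[unfolded stationary_def, rule_format]) simp
    also have "\<dots> = \<mu>" unfolding seq1 \<mu>_def ..
    finally show "distr \<mu> \<mu> shift = \<mu>" .
  qed
  interpret measure_preserving \<mu> shift by (rule mp)
  have erg: "measure \<mu> A \<in> {0, 1}" if A: "A \<in> sets \<mu>" and inv: "AE x in \<mu>. x \<in> A \<longleftrightarrow> shift x \<in> A" for A
  proof -
    have "AE \<omega> in P. seq_from X 1 \<omega> \<in> A \<longleftrightarrow> seq_from X 2 \<omega> \<in> A"
      using AE_distrD[OF Ym inv[unfolded \<mu>_def]] unfolding seq1 seq2 .
    then have "measure P {\<omega>\<in>space P. seq_from X 1 \<omega> \<in> A} \<in> {0, 1}"
      using assms(4) A unfolding ergodic_def sets\<mu> by blast
    moreover have "measure \<mu> A = measure P {\<omega>\<in>space P. seq_from X 1 \<omega> \<in> A}"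
      unfolding \<mu>_def seq1 using A by (subst measure_distr[OF Ym]) (auto simp: sets\<mu> intro!: arg_cong[where f = "measure P"])
    ultimately show ?thesis by simp
  qed
  have "AE x in \<mu>. x 0 \<noteq> x (1::nat)"
  proof -
    have "{\<omega>\<in>space P. X 1 \<omega> = X 2 \<omega>} \<in> null_sets P"
      using assms(7) by (intro null_setsI) (simp_all add: P.emeasure_eq_measure)
    then have "AE \<omega> in P. X 1 \<omega> \<noteq> X 2 \<omega>"
      by (rule AE_I') auto
    then have "AE \<omega> in P. ?Y \<omega> 0 \<noteq> ?Y \<omega> 1" by (simp add: numeral_2_eq_2)
    moreover have "{x \<in> space seq_algebra. x 0 \<noteq> x (1::nat)} \<in> sets seq_algebra"
      by (intro borel_measurable_neq coordinate_measurable)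
    ultimately show ?thesis
      unfolding \<mu>_def using AE_distr_iff[OF Ym, of "\<lambda>x. x 0 \<noteq> x 1"] by blast
  qed
  then have pos: "measure \<mu> local_min > 0" by (intro prob_local_min_pos[OF mp sets\<mu> erg])
  have "\<exists>c>0. AE x in \<mu>. \<forall>B::nat. \<forall>\<^sub>F n in sequentially.
      c * real n + real B \<le> birkhoff_sum shift (indicator local_min) n x"
    using local_min_measurable sets\<mu> pos
    by (intro ergodic_visits erg) (auto simp: sets_eq_imp_space_eq[OF sets\<mu>] space_PiM)
  then obtain c where c: "c > 0" and visits: "AE x in \<mu>. \<forall>B::nat. \<forall>\<^sub>F n in sequentially.
      c * real n + real B \<le> birkhoff_sum shift (indicator local_min) n x" by blast
  obtain M where M: "mono_on {gen_inverse g M..} g"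
    using assms(15) unfolding largely_nondecreasing_def by (elim conjE exE)
  have gm [measurable]: "(\<lambda>a. g (2 * \<bar>a\<bar>)) \<in> borel_measurable borel" by (rule g_abs_measurable[OF gcont])
  have tm [measurable]: "tail_part g k \<in> borel_measurable borel" for k
    unfolding tail_part_def by measurable
  have tpos: "0 \<le> tail_part g k a" "tail_part g k a \<le> g (2 * \<bar>a\<bar>)" for k a
    by (simp_all add: tail_part_def gpos)
  have gint: "integrable \<mu> (\<lambda>x. g (2 * \<bar>x 0\<bar>))"
  proof -
    have pw: "integrable P (\<lambda>\<omega>. g (2 * \<bar>X 1 \<omega>\<bar>) powr (1 + \<epsilon>))"
      using assms(17) by (intro integrableI_nonneg) auto
    have "integrable P (\<lambda>\<omega>. g (2 * \<bar>X 1 \<omega>\<bar>))"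
    proof (rule Bochner_Integration.integrable_bound[of P "\<lambda>\<omega>. 1 + g (2 * \<bar>X 1 \<omega>\<bar>) powr (1 + \<epsilon>)"])
      show "AE \<omega> in P. norm (g (2 * \<bar>X 1 \<omega>\<bar>)) \<le> norm (1 + g (2 * \<bar>X 1 \<omega>\<bar>) powr (1 + \<epsilon>))"
      proof (rule AE_I2)
        fix \<omega>
        let ?y = "g (2 * \<bar>X 1 \<omega>\<bar>)"
        have "?y \<le> 1 + ?y powr (1 + \<epsilon>)"
        proof (cases "?y \<le> 1")
          case True
          then show ?thesis by (meson add_increasing2 powr_ge_zero)
        next
          case False
          then have "?y powr 1 \<le> ?y powr (1 + \<epsilon>)" using assms(16) by (intro powr_mono) auto
          then show ?thesis using False by simp
        qed
        then show "norm ?y \<le> norm (1 + ?y powr (1 + \<epsilon>))" using gpos[of "2 * \<bar>X 1 \<omega>\<bar>"] by simp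
      qed
    qed (use pw in auto)
    then show ?thesis unfolding \<mu>_def by (subst integrable_distr_eq[OF Ym]) auto
  qed
  have tmeas [measurable]: "(\<lambda>x. tail_part g k (x 0)) \<in> borel_measurable \<mu>" for k
    unfolding measurable_cong_sets[OF sets\<mu> refl] by measurable
  have tail: "AE x in \<mu>. \<forall>\<delta>>0. \<exists>k. \<forall>n. birkhoff_sum shift (\<lambda>x. tail_part g k (x 0)) n x \<le> \<delta> * real n"
  proof (rule maximal_inequality_null)
    show "integrable \<mu> (\<lambda>x. tail_part g k (x 0))" for k
      by (rule Bochner_Integration.integrable_bound[OF gint tmeas]) (auto simp: tpos gpos)
    have "(\<lambda>k. \<integral>x. tail_part g k (x 0) \<partial>\<mu>) \<longlonglongrightarrow> (\<integral>x. 0 \<partial>\<mu>)"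
    proof (rule integral_dominated_convergence[OF _ tmeas gint])
      show "AE x in \<mu>. (\<lambda>k. tail_part g k (x 0)) \<longlonglongrightarrow> 0"
      proof (rule AE_I2, rule tendsto_eventually)
        fix x :: "nat \<Rightarrow> real"
        obtain k0 where "2 * \<bar>x 0\<bar> \<le> real k0" using real_arch_simple by blast
        show "\<forall>\<^sub>F k in sequentially. tail_part g k (x 0) = 0"
          using eventually_ge_at_top[of k0]
          by eventually_elim (use \<open>2 * \<bar>x 0\<bar> \<le> real k0\<close> in \<open>auto simp: tail_part_def\<close>)
      qed
    qed (auto simp: tpos)
    then show "(\<lambda>k. \<integral>x. tail_part g k (x 0) \<partial>\<mu>) \<longlonglongrightarrow> 0" by simp
  qed (rule tpos)
  from AE_distrD[OF Ym visits[unfolded \<mu>_def]] AE_distrD[OF Ym tail[unfolded \<mu>_def]] assms(10)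
  show ?thesis
  proof eventually_elim
    case (elim \<omega>)
    let ?x = "\<lambda>k. X k \<omega>"
    show ?case
    proof (rule barcode_average_converges[OF assms(11) gpos gcont M c _ _ elim(3) assms(9,8,18)])
      \<comment> \<open>Two of the three spare visits pay for the ends of the sequence, one for the infinite bar.\<close>
      have "\<forall>\<^sub>F n in sequentially. c * real n + real 3 \<le> birkhoff_sum shift (indicator local_min) n (?Y \<omega>)"
        using elim(1) by blast
      then show "\<forall>\<^sub>F n in sequentially. c * real n \<le> real (card (mortal_bars ?x n))"
      proof eventually_elim
        case (elim n)
        then show ?case
          using birkhoff_sum_local_min[of n ?x] card_local_minima_le[of n ?x] by linarith
      qed
      show "\<forall>\<delta>>0. \<exists>k. \<forall>n. (\<Sum>i=1..n. tail_part g k (X i \<omega>)) \<le> \<delta> * real n"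
        using elim(2) birkhoff_sum_coordinate[of "tail_part g _" _ ?x] by simp
    qed
  qed
qed

end
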